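(* Let $\alpha\in(0,1)$ and $1<p<\frac{1}{1-\alpha}$. Then the fractional Hegselmann--Krause optimal control problem with leadership, namely: minimize $$\mathcal J(x,u)=\int_0^T\Biggl[\frac{1}{2N^2}\sum_{i,j=1}^N\|x_i(t)-x_j(t)\|^2+\frac12\sum_{i=1}^N\|x_0(t)-x_i(t)\|^2+\frac{\nu}{2}\|u(t)\|^2\Biggr]dt$$ subject to $$\begin{cases}D^{\alpha}_{0+}[x_0](t)=u(t),\\ D^{\alpha}_{0+}[x_i](t)=\sum_{j=1}^N a_{ij}(x_j(t)-x_i(t))+c_i(x_0(t)-x_i(t)),\quad i=1,\dots,N,\end{cases}\qquad\text{for a.e. }t\in[0,T],$$ $$I^{1-\alpha}_{0+}[x_j](0)=x_{j0},\quad j=0,1,\dots,N,\qquad u(t)\in M,\ t\in[0,T],$$ has an optimal solution $(x_*,u_* )$ in the set $$\left(I^{\alpha}_{0+}\bigl(L^p([0,T];(\mathbb R^d)^{N+1})\bigr)+\left\{\frac{c}{t^{1-\alpha}}:c\in(\mathbb R^d)^{N+1}\right\}\right)\times\mathcal U_M .$$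
   Context: Data: $T>0$, integers $d\ge1$ and $N>1$, constants $a_{ij}\ge0$ and $c_i\ge0$ ($i,j=1,\dots,N$), $\nu>0$, $K\geq 0$, and initial data $x_{j0}\in\mathbb R^d$ ($j=0,\dots,N$). $\|\cdot\|$ is the Euclidean norm on $\mathbb R^d$. The state is $x=(x_0,x_1,\dots,x_N):[0,T]\to(\mathbb R^d)^{N+1}$ ($x_0$ is the leader, $x_1,\dots,x_N$ are the agents). The control takes values in $M=\{v\in\mathbb R^d:\|v\|\le K\}$, and $\mathcal U_M=\{u\in L^1([0,T];\mathbb R^d):u(t)\in M,\ t\in[0,T]\}$. Left Riemann--Liouville fractional integral of order $\beta>0$ of $f\in L^1([0,T];\mathbb R^n)$: $$I^{\beta}_{0+}[f](t)=\frac1{\Gamma(\beta)}\int_0^t\frac{f(\tau)}{(t-\tau)^{1-\beta}}\,d\tau\quad\text{for a.e. }t\in[0,T].$$ $I^{\alpha}_{0+}(L^p)$ denotes the set of functions of the form $I^\alpha_{0+}[g]$ with $g\in L^p$. For $\alpha\in(0,1)$ and $f$ such that $I^{1-\alpha}_{0+}[f]$ is absolutely continuous (has an absolutely continuous representative), the left Riemann--Liouville derivative is $D^{\alpha}_{0+}[f](t)=\frac{d}{dt}I^{1-\alpha}_{0+}[f](t)$ for a.e. $t$; the value $I^{1-\alpha}_{0+}[f](0)$ is that of the absolutely continuous representative. A pair $(x,u)$ in the displayed product set is admissible if it satisfies the system a.e. together with the initial conditions. It is an optimal solution if it is admissible and $\mathcal J(x_*,u_* )\le\mathcal J(x,u)$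 for every admissible pair $(x,u)$ in that set, where $\mathcal J$ (the integral of a nonnegative function) takes values in $[0,+\infty]$. *)

theory Defs
  imports "HOL-Analysis.Analysis"
begin

text \<open>
  Functions on \<open>[0,T]\<close> are total functions on \<open>real\<close> whose values outside \<open>{0..T}\<close> play no role.
  The measure \<open>lebesgue_on {0..T}\<close> is complete, so the notions below that only involve
  almost-everywhere statements and integrals do not depend on the representative.
\<close>

definition Lp_space :: "real \<Rightarrow> real \<Rightarrow> (real \<Rightarrow> 'a::euclidean_space) set" where
  "Lp_space p T = {f \<in> borel_measurable (lebesgue_on {0..T}).
     integrable (lebesgue_on {0..T}) (\<lambda>t. norm (f t) powr p)}"

definition RL_integral :: "real \<Rightarrow> (real \<Rightarrow> 'a::euclidean_space) \<Rightarrow> real \<Rightarrow> 'a" where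
  "RL_integral \<beta> f t =
     (1 / Gamma \<beta>) *\<^sub>R (LINT \<tau>:{0..t}|lebesgue. f \<tau> /\<^sub>R (t - \<tau>) powr (1 - \<beta>))"

definition RL_integral_Lp :: "real \<Rightarrow> real \<Rightarrow> real \<Rightarrow> (real \<Rightarrow> 'a::euclidean_space) set" where
  "RL_integral_Lp \<alpha> p T =
     {f. \<exists>g \<in> Lp_space p T. AE t in lebesgue_on {0..T}. f t = RL_integral \<alpha> g t}"

definition abs_continuous_on_interval ::
    "real \<Rightarrow> real \<Rightarrow> (real \<Rightarrow> 'a::euclidean_space) \<Rightarrow> bool" where
  "abs_continuous_on_interval a b F \<longleftrightarrow>
     (\<forall>\<epsilon>>0. \<exists>\<delta>>0. \<forall>(n::nat) l r.
        (\<forall>k<n. a \<le> l k \<and> l k \<le> r k \<and> r k \<le> b) \<and>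
        disjoint_family_on (\<lambda>k. {l k<..<r k}) {..<n} \<and>
        (\<Sum>k<n. r k - l k) < \<delta> \<longrightarrow>
        (\<Sum>k<n. norm (F (r k) - F (l k))) < \<epsilon>)"

text \<open>
  \<open>F\<close> is the absolutely continuous representative of the Riemann--Liouville integral of order
  \<open>1 - \<alpha>\<close> of \<open>f\<close>. For \<open>T > 0\<close> its values on \<open>{0..T}\<close> are unique, so the two relations
  that follow are single-valued (the first one up to null sets).
\<close>

definition RL_AC_rep ::
    "real \<Rightarrow> real \<Rightarrow> (real \<Rightarrow> 'a::euclidean_space) \<Rightarrow> (real \<Rightarrow> 'a) \<Rightarrow> bool" where
  "RL_AC_rep \<alpha> T f F \<longleftrightarrow>
     abs_continuous_on_interval 0 T F \<and>
     (AE t in lebesgue_on {0..T}. F t = RL_integral (1 - \<alpha>) f t)"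

definition has_RL_derivative ::
    "real \<Rightarrow> real \<Rightarrow> (real \<Rightarrow> 'a::euclidean_space) \<Rightarrow> (real \<Rightarrow> 'a) \<Rightarrow> bool" where
  "has_RL_derivative \<alpha> T f g \<longleftrightarrow>
     (\<exists>F. RL_AC_rep \<alpha> T f F \<and>
        (AE t in lebesgue_on {0..T}. (F has_vector_derivative g t) (at t within {0..T})))"

definition has_RL_initial_value ::
    "real \<Rightarrow> real \<Rightarrow> (real \<Rightarrow> 'a::euclidean_space) \<Rightarrow> 'a \<Rightarrow> bool" where
  "has_RL_initial_value \<alpha> T f y \<longleftrightarrow> (\<exists>F. RL_AC_rep \<alpha> T f F \<and> F 0 = y)"

text \<open>
  The \<open>N\<close> agents are the elements of a finite type \<open>'n\<close> with \<open>N = CARD('n)\<close>. A state is a vector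
  indexed by \<open>'n option\<close>: the component \<open>None\<close> is the leader \<open>x\<^sub>0\<close>, the component
  \<open>Some i\<close> is the agent \<open>x\<^sub>i\<close>.
\<close>

definition state_space ::
    "real \<Rightarrow> real \<Rightarrow> real \<Rightarrow> (real \<Rightarrow> (real^'d)^('n::finite option)) set" where
  "state_space \<alpha> p T =
     {x. \<exists>y \<in> RL_integral_Lp \<alpha> p T. \<exists>c. AE t in lebesgue_on {0..T}.
           x t = y t + c /\<^sub>R t powr (1 - \<alpha>)}"

definition control_set :: "real \<Rightarrow> real \<Rightarrow> (real \<Rightarrow> real^'d) set" where
  "control_set K T =
     {u. integrable (lebesgue_on {0..T}) u \<and> (\<forall>t\<in>{0..T}. u t \<in> {v. norm v \<le> K})}"

definition HK_admissible ::
    "real \<Rightarrow> real \<Rightarrow> real \<Rightarrow> real \<Rightarrow> ('n::finite \<Rightarrow> 'n \<Rightarrow> real) \<Rightarrow> ('n \<Rightarrow> real) \<Rightarrow>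
     (real^'d)^('n option) \<Rightarrow> ((real \<Rightarrow> (real^'d)^('n option)) \<times> (real \<Rightarrow> real^'d)) set" where
  "HK_admissible \<alpha> p T K a c xinit =
     {(x, u) \<in> state_space \<alpha> p T \<times> control_set K T.
        has_RL_derivative \<alpha> T (\<lambda>t. x t $ None) u \<and>
        (\<forall>i. has_RL_derivative \<alpha> T (\<lambda>t. x t $ Some i)
           (\<lambda>t. (\<Sum>j\<in>UNIV. a i j *\<^sub>R (x t $ Some j - x t $ Some i))
                 + c i *\<^sub>R (x t $ None - x t $ Some i))) \<and>
        (\<forall>k. has_RL_initial_value \<alpha> T (\<lambda>t. x t $ k) (xinit $ k))}"

definition HK_cost ::
    "real \<Rightarrow> real \<Rightarrow> (real \<Rightarrow> (real^'d)^('n::finite option)) \<Rightarrow> (real \<Rightarrow> real^'d) \<Rightarrow> ennreal" where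
  "HK_cost T \<nu> x u =
     (\<integral>\<^sup>+ t. ennreal
        (1 / (2 * (real CARD('n))\<^sup>2)
           * (\<Sum>i\<in>UNIV. \<Sum>j\<in>UNIV. (norm (x t $ Some i - x t $ Some j))\<^sup>2)
         + 1 / 2 * (\<Sum>i\<in>UNIV. (norm (x t $ None - x t $ Some i))\<^sup>2)
         + \<nu> / 2 * (norm (u t))\<^sup>2) \<partial>lebesgue_on {0..T})"

definition HK_optimal ::
    "real \<Rightarrow> real \<Rightarrow> real \<Rightarrow> real \<Rightarrow> real \<Rightarrow> ('n::finite \<Rightarrow> 'n \<Rightarrow> real) \<Rightarrow> ('n \<Rightarrow> real) \<Rightarrow>
     (real^'d)^('n option) \<Rightarrow> (real \<Rightarrow> (real^'d)^('n option)) \<Rightarrow> (real \<Rightarrow> real^'d) \<Rightarrow> bool" where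
  "HK_optimal \<alpha> p T \<nu> K a c xinit x u \<longleftrightarrow>
     (x, u) \<in> HK_admissible \<alpha> p T K a c xinit \<and>
     (\<forall>(y, v) \<in> HK_admissible \<alpha> p T K a c xinit. HK_cost T \<nu> x u \<le> HK_cost T \<nu> y v)"

end

(* Convolving with the kernel s^(beta - 1) / Gamma beta has norm at most l^(- beta) on L^1([0,T]) weighted by
   exp (- l t).  Hence the state equation x = t^(alpha - 1) xinit / Gamma alpha + I^alpha [L x + B u] has for each
   control exactly one solution, which depends Lipschitz continuously on u in L^1; it is reached by a Picard series
   dominated by a multiple of t^(alpha - 1), which puts L x + B u into L^p.  By the semigroup property of I^beta and
   the Lebesgue differentiation theorem, this integral equation is equivalent to admissibility.
   The cost is strongly convex in the control (nu > 0), so by the parallelogram identity the controls of a minimizing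
   sequence form a Cauchy sequence and no weak compactness is needed; Fatou's lemma along an a.e. convergent
   subsequence gives optimality of the limit.  If the infimum is infinite (possible for alpha <= 1/2), every
   admissible pair is optimal. *)

theory Submission
  imports Defs
begin

section \<open>Riemann--Liouville integrals\<close>

text \<open>Nonzero initial data contribute a term that is singular like t^(\<alpha> - 1) at 0.
  Stability lives in L^1, where the quadratic cost is not continuous, so only lower semicontinuity
  is left for the limit. A weighted L^1 contraction alone would give a solution in L^1, while the
  state space asks for a fractional integral of an L^p function. This is why existence is proved
  with pointwise bounds by kernels; t^(\<alpha> - 1) lies in L^p precisely when p < 1 / (1 -
  \<alpha>). One kernel, extended by 0 to the nonpositive reals, serves throughout. The variable
  upper limit of I^\<beta> disappears, Tonelli and Fubini apply on a square, and I^\<beta>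
  I^\<gamma> = I^(\<beta> + \<gamma>) becomes a convolution identity. The singular term is a
  multiple of the same kernel; it behaves like I^\<alpha> of a point mass at 0.\<close>

definition RL_kernel :: "real \<Rightarrow> real \<Rightarrow> real" where
  "RL_kernel \<beta> s = (if 0 < s then s powr (\<beta> - 1) / Gamma \<beta> else 0)"

lemma RL_kernel_measurable [measurable]: "RL_kernel \<beta> \<in> borel_measurable borel"
  unfolding RL_kernel_def by measurable

lemma RL_kernel_nonneg [simp]: "0 < \<beta> \<Longrightarrow> 0 \<le> RL_kernel \<beta> s"
  by (simp add: RL_kernel_def Gamma_real_pos less_imp_le)

lemma RL_kernel_nonpos [simp]: "s \<le> 0 \<Longrightarrow> RL_kernel \<beta> s = 0"
  by (simp add: RL_kernel_def)

lemma RL_kernel_one: "RL_kernel 1 s = (if 0 < s then 1 else 0)"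
  by (simp add: RL_kernel_def)

text \<open>The Laplace transform of the kernel at \<open>l\<close>, from the substitution t = l s
  in Euler's integral for Gamma. It is the source of the factor \<open>l powr - \<beta>\<close> in
  every weighted estimate.\<close>

lemma nn_integral_RL_kernel_exp:
  assumes "0 < \<beta>" "0 < l"
  shows "(\<integral>\<^sup>+ s. ennreal (exp (- (l * s)) * RL_kernel \<beta> s) \<partial>lborel) = ennreal (l powr - \<beta>)"
proof -
  define X where "X = (\<integral>\<^sup>+ s. ennreal (exp (- (l * s)) * RL_kernel \<beta> s) \<partial>lborel)"
  have G: "0 < Gamma \<beta>" using assms by (simp add: Gamma_real_pos)
  have G': "Gamma \<beta> \<noteq> 0" using G by linarith
  have "ennreal (Gamma \<beta>) = (\<integral>\<^sup>+ t. ennreal (indicator {0..} t * t powr (\<beta> - 1) / exp t) \<partial>lborel)"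
    using Gamma_conv_nn_integral_real[OF assms(1)] by simp
  also have "\<dots> = ennreal \<bar>l\<bar> * (\<integral>\<^sup>+ s. ennreal (indicator {0..} (0 + l * s) * (0 + l * s) powr (\<beta> - 1) / exp (0 + l * s)) \<partial>lborel)"
    using assms by (intro nn_integral_real_affine) auto
  also have "(\<integral>\<^sup>+ s. ennreal (indicator {0..} (0 + l * s) * (0 + l * s) powr (\<beta> - 1) / exp (0 + l * s)) \<partial>lborel)
     = (\<integral>\<^sup>+ s. ennreal (l powr (\<beta> - 1) * Gamma \<beta>) * ennreal (exp (- (l * s)) * RL_kernel \<beta> s) \<partial>lborel)"
  proof (intro nn_integral_cong)
    fix s :: real
    show "ennreal (indicator {0..} (0 + l * s) * (0 + l * s) powr (\<beta> - 1) / exp (0 + l * s))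
        = ennreal (l powr (\<beta> - 1) * Gamma \<beta>) * ennreal (exp (- (l * s)) * RL_kernel \<beta> s)"
      using assms G G'
      by (subst ennreal_mult[symmetric])
         (auto simp: RL_kernel_def powr_mult exp_minus field_simps indicator_def zero_le_mult_iff)
  qed
  also have "\<dots> = ennreal (l powr (\<beta> - 1) * Gamma \<beta>) * X"
    unfolding X_def by (intro nn_integral_cmult) auto
  finally have eq: "ennreal (Gamma \<beta>) = ennreal \<bar>l\<bar> * (ennreal (l powr (\<beta> - 1) * Gamma \<beta>) * X)" .
  \<comment> \<open>An equation in \<open>ennreal\<close> can be solved for \<open>X\<close> only
    once \<open>X\<close> is known to be finite.\<close>
  have "X \<noteq> \<infinity>"
  proof
    assume "X = \<infinity>"
    then have "ennreal (Gamma \<beta>) = \<infinity>"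
      using eq assms G G' by (simp add: ennreal_mult_top)
    then show False by simp
  qed
  then obtain r where r: "X = ennreal r" "0 \<le> r"
    by (cases X) auto
  have "Gamma \<beta> = l * (l powr (\<beta> - 1) * Gamma \<beta> * r)"
    using eq assms G r by (simp add: ennreal_mult[symmetric] zero_le_mult_iff)
  then have "1 = l powr \<beta> * r"
    using G assms by (simp add: powr_diff field_simps)
  then have "r = l powr - \<beta>"
    using assms by (simp add: powr_minus field_simps)
  then show ?thesis using r X_def by simp
qed

text \<open>The substitution r = s + (t - s) v leads to the Beta integral, whose value Gamma
  \<gamma> * Gamma \<beta> / Gamma (\<gamma> + \<beta>) cancels the normalising constants of the two
  kernels.\<close>

lemma nn_integral_RL_kernel_conv:
  assumes b: "0 < \<beta>" and g: "0 < \<gamma>"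
  shows "(\<integral>\<^sup>+ r. ennreal (RL_kernel \<beta> (t - r) * RL_kernel \<gamma> (r - s)) \<partial>lborel) = ennreal (RL_kernel (\<beta> + \<gamma>) (t - s))"
proof (cases "s < t")
  case False
  then have "RL_kernel \<beta> (t - r) * RL_kernel \<gamma> (r - s) = 0" for r
    by (auto simp: RL_kernel_def)
  from this[abs_def] show ?thesis using False by (simp only:) simp
next
  case True
  define w where "w = t - s"
  have w: "0 < w" using True by (simp add: w_def)
  have G: "0 < Gamma \<beta>" "0 < Gamma \<gamma>" "0 < Gamma (\<beta> + \<gamma>)"
    using assms by (auto simp: Gamma_real_pos)
  have Beta: "(\<integral>\<^sup>+ v. ennreal (indicator {0..1} v * (v powr (\<gamma> - 1) * (1 - v) powr (\<beta> - 1))) \<partial>lborel) = ennreal (Beta \<gamma> \<beta>)"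
    by (rule nn_integral_has_integral_lebesgue[OF _ has_integral_Beta_real[OF g b]]) simp
  have "(\<integral>\<^sup>+ r. ennreal (RL_kernel \<beta> (t - r) * RL_kernel \<gamma> (r - s)) \<partial>lborel)
      = ennreal \<bar>w\<bar> * (\<integral>\<^sup>+ v. ennreal (RL_kernel \<beta> (t - (s + w * v)) * RL_kernel \<gamma> ((s + w * v) - s)) \<partial>lborel)"
    using w by (intro nn_integral_real_affine) auto
  also have "(\<integral>\<^sup>+ v. ennreal (RL_kernel \<beta> (t - (s + w * v)) * RL_kernel \<gamma> ((s + w * v) - s)) \<partial>lborel)
     = (\<integral>\<^sup>+ v. ennreal (w powr (\<beta> - 1) * w powr (\<gamma> - 1) / (Gamma \<beta> * Gamma \<gamma>)) *
         ennreal (indicator {0..1} v * (v powr (\<gamma> - 1) * (1 - v) powr (\<beta> - 1))) \<partial>lborel)"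
  proof (intro nn_integral_cong)
    fix v :: real
    have e: "t - (s + w * v) = w * (1 - v)" by (simp add: w_def algebra_simps)
    consider "v \<le> 0" | "v \<ge> 1" | "0 < v" "v < 1" by linarith
    then show "ennreal (RL_kernel \<beta> (t - (s + w * v)) * RL_kernel \<gamma> ((s + w * v) - s))
      = ennreal (w powr (\<beta> - 1) * w powr (\<gamma> - 1) / (Gamma \<beta> * Gamma \<gamma>)) *
         ennreal (indicator {0..1} v * (v powr (\<gamma> - 1) * (1 - v) powr (\<beta> - 1)))"
    proof cases
      case 1
      then have "RL_kernel \<gamma> ((s + w * v) - s) = 0"
        using w by (simp add: RL_kernel_def zero_less_mult_iff)
      \<comment> \<open>At v = 0 the indicator is 1, but \<open>0 powr _ = 0\<close> still makes the
        right-hand side vanish; the endpoint v = 1 in the next case is alike.\<close>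
      moreover have "v = 0 \<or> v \<notin> {0..1}" using 1 by auto
      ultimately show ?thesis by auto
    next
      case 2
      then have "RL_kernel \<beta> (t - (s + w * v)) = 0"
        unfolding e using w by (simp add: RL_kernel_def zero_less_mult_iff)
      moreover have "v = 1 \<or> v \<notin> {0..1}" using 2 by auto
      ultimately show ?thesis by auto
    next
      case 3
      then have "RL_kernel \<beta> (t - (s + w * v)) = w powr (\<beta> - 1) * (1 - v) powr (\<beta> - 1) / Gamma \<beta>"
        "RL_kernel \<gamma> ((s + w * v) - s) = w powr (\<gamma> - 1) * v powr (\<gamma> - 1) / Gamma \<gamma>"
        unfolding e using w by (auto simp: RL_kernel_def powr_mult)
      then have e': "RL_kernel \<beta> (t - (s + w * v)) * RL_kernel \<gamma> ((s + w * v) - s) =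
        w powr (\<beta> - 1) * w powr (\<gamma> - 1) / (Gamma \<beta> * Gamma \<gamma>) * (indicator {0..1} v * (v powr (\<gamma> - 1) * (1 - v) powr (\<beta> - 1)))"
        using 3 by (simp only:) simp
      show ?thesis
        unfolding e' using G by (intro ennreal_mult) auto
    qed
  qed
  also have "\<dots> = ennreal (w powr (\<beta> - 1) * w powr (\<gamma> - 1) / (Gamma \<beta> * Gamma \<gamma>)) * ennreal (Beta \<gamma> \<beta>)"
    by (subst nn_integral_cmult) (auto simp: Beta)
  also have "ennreal \<bar>w\<bar> * \<dots> = ennreal (w * (w powr (\<beta> - 1) * w powr (\<gamma> - 1) / (Gamma \<beta> * Gamma \<gamma>) * Beta \<gamma> \<beta>))"
    using w G by (simp add: ennreal_mult[symmetric] Beta_def add.commute)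
  also have "w * (w powr (\<beta> - 1) * w powr (\<gamma> - 1) / (Gamma \<beta> * Gamma \<gamma>) * Beta \<gamma> \<beta>) = RL_kernel (\<beta> + \<gamma>) w"
    using w G by (simp add: Beta_def RL_kernel_def powr_diff powr_add add.commute field_simps power2_eq_square)
  finally show ?thesis by (simp add: w_def)
qed

section \<open>Weighted L^1 estimates on a finite horizon\<close>

locale horizon =
  fixes T :: real
  assumes T_pos: "0 < T"
begin

abbreviation M :: "real measure" where "M \<equiv> lebesgue_on {0..T}"

sublocale M: finite_measure M
  by (rule finite_measure_lebesgue_on) simp

sublocale MM: pair_sigma_finite M M ..

lemma id_measurable_M [measurable]: "(\<lambda>t. t) \<in> borel_measurable M"
  by (intro measurable_restrict_space1 measurable_completion) simp

text \<open>With its companion for \<open>snd\<close>, this makes kernels of the difference of the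
  two variables measurable on the square for the method \<open>measurable\<close>.\<close>

lemma fst_measurable_MM [measurable]: "fst \<in> borel_measurable (M \<Otimes>\<^sub>M M)"
  using measurable_compose[OF measurable_fst id_measurable_M] by simp

lemma snd_measurable_MM [measurable]: "snd \<in> borel_measurable (M \<Otimes>\<^sub>M M)"
  using measurable_compose[OF measurable_snd id_measurable_M] by simp

lemma kernel_measurable_M [measurable]: "(\<lambda>\<tau>. RL_kernel \<beta> (t - \<tau>)) \<in> borel_measurable M"
  by measurable

lemma nn_integral_M: "(\<integral>\<^sup>+ t. f t \<partial>M) = (\<integral>\<^sup>+ t. f t * indicator {0..T} t \<partial>lborel)"
  by (subst nn_integral_restrict_space) (auto simp: nn_integral_completion)

lemma kernel_exp_le:
  assumes "0 < \<beta>" "0 < l"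
  shows "(\<integral>\<^sup>+ t. ennreal (exp (- (l * (t - s))) * RL_kernel \<beta> (t - s)) \<partial>M) \<le> ennreal (l powr - \<beta>)"
proof -
  have "(\<integral>\<^sup>+ t. ennreal (exp (- (l * (t - s))) * RL_kernel \<beta> (t - s)) \<partial>M)
      \<le> (\<integral>\<^sup>+ t. ennreal (exp (- (l * (t - s))) * RL_kernel \<beta> (t - s)) \<partial>lborel)"
    unfolding nn_integral_M by (intro nn_integral_mono) (auto simp: indicator_def)
  also have "\<dots> = ennreal \<bar>1\<bar> * (\<integral>\<^sup>+ t. ennreal (exp (- (l * ((s + 1 * t) - s))) * RL_kernel \<beta> ((s + 1 * t) - s)) \<partial>lborel)"
    by (intro nn_integral_real_affine) auto
  also have "\<dots> = ennreal (l powr - \<beta>)"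
    using nn_integral_RL_kernel_exp[OF assms] by simp
  finally show ?thesis .
qed

text \<open>The integrand vanishes unless s < r < t, and that interval lies in [0,T], so restricting
  the integral to \<open>M\<close> loses nothing.\<close>

lemma kernel_conv:
  assumes "0 < \<beta>" "0 < \<gamma>" "t \<le> T" "0 \<le> s"
  shows "(\<integral>\<^sup>+ r. ennreal (RL_kernel \<beta> (t - r) * RL_kernel \<gamma> (r - s)) \<partial>M) = ennreal (RL_kernel (\<beta> + \<gamma>) (t - s))"
proof -
  have "(\<integral>\<^sup>+ r. ennreal (RL_kernel \<beta> (t - r) * RL_kernel \<gamma> (r - s)) \<partial>M)
     = (\<integral>\<^sup>+ r. ennreal (RL_kernel \<beta> (t - r) * RL_kernel \<gamma> (r - s)) \<partial>lborel)"
    unfolding nn_integral_M using assms(3,4)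
    by (intro nn_integral_cong) (auto simp: indicator_def RL_kernel_def)
  then show ?thesis using nn_integral_RL_kernel_conv[OF assms(1,2)] by simp
qed

text \<open>Since exp (- l t) = exp (- l (t - \<tau>)) * exp (- l \<tau>), the weight splits between
  kernel and function. After exchanging the integrals, the inner one is bounded by the Laplace
  transform of the kernel. With \<open>g\<close> valued in \<open>ennreal\<close>, the estimate can
  be used before any integrability is known.\<close>

lemma weighted_Tonelli:
  fixes g :: "real \<Rightarrow> ennreal"
  assumes b: "0 < \<beta>" and l: "0 < l" and g [measurable]: "g \<in> borel_measurable M"
  shows "(\<integral>\<^sup>+ t. ennreal (exp (- (l * t))) * (\<integral>\<^sup>+ \<tau>. ennreal (RL_kernel \<beta> (t - \<tau>)) * g \<tau> \<partial>M) \<partial>M)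
    \<le> ennreal (l powr - \<beta>) * (\<integral>\<^sup>+ t. ennreal (exp (- (l * t))) * g t \<partial>M)"
proof -
  have "(\<integral>\<^sup>+ t. ennreal (exp (- (l * t))) * (\<integral>\<^sup>+ \<tau>. ennreal (RL_kernel \<beta> (t - \<tau>)) * g \<tau> \<partial>M) \<partial>M)
     = (\<integral>\<^sup>+ t. \<integral>\<^sup>+ \<tau>. ennreal (exp (- (l * (t - \<tau>))) * RL_kernel \<beta> (t - \<tau>)) * (ennreal (exp (- (l * \<tau>))) * g \<tau>) \<partial>M \<partial>M)"
  proof (intro nn_integral_cong)
    fix t
    have "(\<integral>\<^sup>+ \<tau>. ennreal (exp (- (l * (t - \<tau>))) * RL_kernel \<beta> (t - \<tau>)) * (ennreal (exp (- (l * \<tau>))) * g \<tau>) \<partial>M)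
       = (\<integral>\<^sup>+ \<tau>. ennreal (exp (- (l * t))) * (ennreal (RL_kernel \<beta> (t - \<tau>)) * g \<tau>) \<partial>M)"
    proof (intro nn_integral_cong)
      fix \<tau>
      have "ennreal (exp (- (l * (t - \<tau>))) * RL_kernel \<beta> (t - \<tau>)) * (ennreal (exp (- (l * \<tau>))) * g \<tau>)
        = ennreal (exp (- (l * (t - \<tau>))) * RL_kernel \<beta> (t - \<tau>) * exp (- (l * \<tau>))) * g \<tau>"
        using b by (subst (2) ennreal_mult) (auto simp: mult.assoc)
      also have "exp (- (l * (t - \<tau>))) * RL_kernel \<beta> (t - \<tau>) * exp (- (l * \<tau>)) = exp (- (l * t)) * RL_kernel \<beta> (t - \<tau>)"
        by (simp add: exp_add[symmetric] algebra_simps)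
      finally show "ennreal (exp (- (l * (t - \<tau>))) * RL_kernel \<beta> (t - \<tau>)) * (ennreal (exp (- (l * \<tau>))) * g \<tau>)
        = ennreal (exp (- (l * t))) * (ennreal (RL_kernel \<beta> (t - \<tau>)) * g \<tau>)"
        using b by (simp add: ennreal_mult mult.assoc)
    qed
    then show "ennreal (exp (- (l * t))) * (\<integral>\<^sup>+ \<tau>. ennreal (RL_kernel \<beta> (t - \<tau>)) * g \<tau> \<partial>M)
     = (\<integral>\<^sup>+ \<tau>. ennreal (exp (- (l * (t - \<tau>))) * RL_kernel \<beta> (t - \<tau>)) * (ennreal (exp (- (l * \<tau>))) * g \<tau>) \<partial>M)"
      by (simp add: nn_integral_cmult)
  qed
  also have "\<dots> = (\<integral>\<^sup>+ \<tau>. \<integral>\<^sup>+ t. ennreal (exp (- (l * (t - \<tau>))) * RL_kernel \<beta> (t - \<tau>)) * (ennreal (exp (- (l * \<tau>))) * g \<tau>) \<partial>M \<partial>M)"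
    by (rule MM.Fubini'[symmetric]) measurable
  also have "\<dots> = (\<integral>\<^sup>+ \<tau>. (\<integral>\<^sup>+ t. ennreal (exp (- (l * (t - \<tau>))) * RL_kernel \<beta> (t - \<tau>)) \<partial>M) * (ennreal (exp (- (l * \<tau>))) * g \<tau>) \<partial>M)"
    by (intro nn_integral_cong nn_integral_multc) measurable
  also have "\<dots> \<le> (\<integral>\<^sup>+ \<tau>. ennreal (l powr - \<beta>) * (ennreal (exp (- (l * \<tau>))) * g \<tau>) \<partial>M)"
    by (intro nn_integral_mono mult_right_mono kernel_exp_le b l) auto
  also have "\<dots> = ennreal (l powr - \<beta>) * (\<integral>\<^sup>+ t. ennreal (exp (- (l * t))) * g t \<partial>M)"
    by (intro nn_integral_cmult) measurable
  finally show ?thesis .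
qed

text \<open>The kernel vanishes for \<tau> \<ge> t and so encodes the upper limit of integration.
  Every later argument integrates over the fixed measure \<open>M\<close>.\<close>

lemma RL_integral_eq:
  fixes f :: "real \<Rightarrow> 'a::euclidean_space"
  assumes t: "t \<in> {0..T}"
  shows "RL_integral \<beta> f t = (\<integral>\<tau>. RL_kernel \<beta> (t - \<tau>) *\<^sub>R f \<tau> \<partial>M)"
proof -
  have "(\<integral>\<tau>. RL_kernel \<beta> (t - \<tau>) *\<^sub>R f \<tau> \<partial>M) = (\<integral>\<tau>. indicator {0..T} \<tau> *\<^sub>R (RL_kernel \<beta> (t - \<tau>) *\<^sub>R f \<tau>) \<partial>lebesgue)"
    by (rule integral_restrict_space) simp
  also have "\<dots> = (\<integral>\<tau>. (1 / Gamma \<beta>) *\<^sub>R (indicator {0..t} \<tau> *\<^sub>R (f \<tau> /\<^sub>R (t - \<tau>) powr (1 - \<beta>))) \<partial>lebesgue)"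
  proof (intro Bochner_Integration.integral_cong refl)
    fix \<tau>
    \<comment> \<open>At \<tau> = t both integrands are 0, because \<open>0 powr _ = 0\<close> and
      \<open>inverse 0 = 0\<close>.\<close>
    have "(t - \<tau>) powr (\<beta> - 1) = inverse ((t - \<tau>) powr (1 - \<beta>))"
      by (simp add: powr_minus[symmetric])
    then show "indicator {0..T} \<tau> *\<^sub>R (RL_kernel \<beta> (t - \<tau>) *\<^sub>R f \<tau>)
      = (1 / Gamma \<beta>) *\<^sub>R (indicator {0..t} \<tau> *\<^sub>R (f \<tau> /\<^sub>R (t - \<tau>) powr (1 - \<beta>)))"
      using t by (auto simp: indicator_def RL_kernel_def field_simps)
  qed
  also have "\<dots> = RL_integral \<beta> f t"
    unfolding RL_integral_def set_lebesgue_integral_def by (rule integral_scaleR_right)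
  finally show ?thesis by simp
qed

lemma RL_integral_measurable:
  fixes f :: "real \<Rightarrow> 'a::euclidean_space"
  assumes [measurable]: "f \<in> borel_measurable M"
  shows "RL_integral \<beta> f \<in> borel_measurable M"
proof -
  have "(\<lambda>t. \<integral>\<tau>. RL_kernel \<beta> (t - \<tau>) *\<^sub>R f \<tau> \<partial>M) \<in> borel_measurable M"
    by measurable
  then show ?thesis
    by (subst measurable_cong[where g = "\<lambda>t. \<integral>\<tau>. RL_kernel \<beta> (t - \<tau>) *\<^sub>R f \<tau> \<partial>M"])
       (auto simp: RL_integral_eq)
qed

lemma RL_integral_cong_AE:
  fixes f g :: "real \<Rightarrow> 'a::euclidean_space"
  assumes [measurable]: "f \<in> borel_measurable M" "g \<in> borel_measurable M"
    and ae: "AE t in M. f t = g t" and t: "t \<in> {0..T}"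
  shows "RL_integral \<beta> f t = RL_integral \<beta> g t"
  unfolding RL_integral_eq[OF t] using ae by (intro integral_cong_AE) auto

text \<open>No integrability is assumed: a Bochner integral that does not exist is 0 by default, and
  then the bound is trivial.\<close>

lemma norm_RL_integral_le:
  fixes f :: "real \<Rightarrow> 'a::euclidean_space"
  assumes b: "0 < \<beta>" and t: "t \<in> {0..T}"
  shows "ennreal (norm (RL_integral \<beta> f t)) \<le> (\<integral>\<^sup>+ \<tau>. ennreal (RL_kernel \<beta> (t - \<tau>)) * ennreal (norm (f \<tau>)) \<partial>M)"
proof (cases "integrable M (\<lambda>\<tau>. RL_kernel \<beta> (t - \<tau>) *\<^sub>R f \<tau>)")
  case True
  then show ?thesis
    unfolding RL_integral_eq[OF t] using b
    by (intro order_trans[OF integral_norm_bound_ennreal])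
       (auto intro!: nn_integral_mono simp: ennreal_mult)
next
  case False
  then show ?thesis
    unfolding RL_integral_eq[OF t] by (simp add: not_integrable_integral_eq)
qed

lemma RL_integral_weighted_le:
  fixes f :: "real \<Rightarrow> 'a::euclidean_space"
  assumes b: "0 < \<beta>" and l: "0 < l" and [measurable]: "f \<in> borel_measurable M"
  shows "(\<integral>\<^sup>+ t. ennreal (exp (- (l * t))) * ennreal (norm (RL_integral \<beta> f t)) \<partial>M)
    \<le> ennreal (l powr - \<beta>) * (\<integral>\<^sup>+ t. ennreal (exp (- (l * t))) * ennreal (norm (f t)) \<partial>M)"
proof -
  have "(\<integral>\<^sup>+ t. ennreal (exp (- (l * t))) * ennreal (norm (RL_integral \<beta> f t)) \<partial>M)
    \<le> (\<integral>\<^sup>+ t. ennreal (exp (- (l * t))) * (\<integral>\<^sup>+ \<tau>. ennreal (RL_kernel \<beta> (t - \<tau>)) * ennreal (norm (f \<tau>)) \<partial>M) \<partial>M)"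
    using b by (intro nn_integral_mono mult_left_mono norm_RL_integral_le) auto
  also have "\<dots> \<le> ennreal (l powr - \<beta>) * (\<integral>\<^sup>+ t. ennreal (exp (- (l * t))) * ennreal (norm (f t)) \<partial>M)"
    using b l by (intro weighted_Tonelli) auto
  finally show ?thesis .
qed

text \<open>On [0,T] the weight lies between exp (- l T) and 1. This lemma and the next make the
  weighted and the plain L^1 norm equivalent.\<close>

lemma exp_weight_upper:
  assumes "0 \<le> l"
  shows "(\<integral>\<^sup>+ t. ennreal (exp (- (l * t))) * g t \<partial>M) \<le> (\<integral>\<^sup>+ t. g t \<partial>M)"
proof (intro nn_integral_mono)
  fix t assume "t \<in> space M"
  then have "ennreal (exp (- (l * t))) * g t \<le> 1 * g t"
    using assms by (intro mult_right_mono) (auto simp: ennreal_le_1)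
  then show "ennreal (exp (- (l * t))) * g t \<le> g t" by simp
qed

lemma exp_weight_lower:
  assumes "0 \<le> l" and [measurable]: "g \<in> borel_measurable M"
  shows "(\<integral>\<^sup>+ t. g t \<partial>M) \<le> ennreal (exp (l * T)) * (\<integral>\<^sup>+ t. ennreal (exp (- (l * t))) * g t \<partial>M)"
proof -
  have "(\<integral>\<^sup>+ t. g t \<partial>M) \<le> (\<integral>\<^sup>+ t. ennreal (exp (l * T)) * (ennreal (exp (- (l * t))) * g t) \<partial>M)"
  proof (intro nn_integral_mono)
    fix t assume "t \<in> space M"
    then have "1 \<le> exp (l * T) * exp (- (l * t))"
      using assms by (simp add: exp_add[symmetric] mult_left_mono)
    then have "1 * g t \<le> ennreal (exp (l * T) * exp (- (l * t))) * g t"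
      by (intro mult_right_mono) (auto simp: ennreal_ge_1)
    then show "g t \<le> ennreal (exp (l * T)) * (ennreal (exp (- (l * t))) * g t)"
      by (simp add: ennreal_mult mult.assoc)
  qed
  also have "\<dots> = ennreal (exp (l * T)) * (\<integral>\<^sup>+ t. ennreal (exp (- (l * t))) * g t \<partial>M)"
    by (intro nn_integral_cmult) measurable
  finally show ?thesis .
qed

text \<open>By Tonelli the inner integral has a finite integral over t, hence is finite almost
  everywhere. The weight with l = 1 is an arbitrary choice.\<close>

lemma kernel_nn_integrable_AE:
  fixes f :: "real \<Rightarrow> 'a::euclidean_space"
  assumes b: "0 < \<beta>" and f: "integrable M f"
  shows "AE t in M. (\<integral>\<^sup>+ \<tau>. ennreal (RL_kernel \<beta> (t - \<tau>)) * ennreal (norm (f \<tau>)) \<partial>M) < \<infinity>"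
proof -
  have [measurable]: "f \<in> borel_measurable M" using f by auto
  let ?h = "\<lambda>t. \<integral>\<^sup>+ \<tau>. ennreal (RL_kernel \<beta> (t - \<tau>)) * ennreal (norm (f \<tau>)) \<partial>M"
  have [measurable]: "?h \<in> borel_measurable M" by measurable
  have "(\<integral>\<^sup>+ t. ?h t \<partial>M) \<le> ennreal (exp (1 * T)) * (\<integral>\<^sup>+ t. ennreal (exp (- (1 * t))) * ?h t \<partial>M)"
    by (intro exp_weight_lower) auto
  also have "(\<integral>\<^sup>+ t. ennreal (exp (- (1 * t))) * ?h t \<partial>M) \<le> ennreal (1 powr - \<beta>) * (\<integral>\<^sup>+ t. ennreal (exp (- (1 * t))) * ennreal (norm (f t)) \<partial>M)"
    using b by (intro weighted_Tonelli) auto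
  also have "(\<integral>\<^sup>+ t. ennreal (exp (- (1 * t))) * ennreal (norm (f t)) \<partial>M) \<le> (\<integral>\<^sup>+ t. ennreal (norm (f t)) \<partial>M)"
    by (intro exp_weight_upper) auto
  also have "ennreal (exp (1 * T)) * (ennreal (1 powr - \<beta>) * (\<integral>\<^sup>+ t. ennreal (norm (f t)) \<partial>M)) < \<infinity>"
    using f by (auto simp: integrable_iff_bounded ennreal_mult_less_top)
  finally have "(\<integral>\<^sup>+ t. ?h t \<partial>M) \<noteq> \<infinity>"
    by (auto simp: mult_left_mono)
  then have "AE t in M. ?h t \<noteq> \<infinity>"
    by (intro nn_integral_PInf_AE) auto
  then show ?thesis by (auto simp: less_top)
qed

lemma kernel_integrableI:
  fixes f :: "real \<Rightarrow> 'a::euclidean_space"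
  assumes b: "0 < \<beta>" and [measurable]: "f \<in> borel_measurable M"
    and "(\<integral>\<^sup>+ \<tau>. ennreal (RL_kernel \<beta> (t - \<tau>)) * ennreal (norm (f \<tau>)) \<partial>M) < \<infinity>"
  shows "integrable M (\<lambda>\<tau>. RL_kernel \<beta> (t - \<tau>) *\<^sub>R f \<tau>)"
  using assms by (intro integrableI_bounded) (auto simp: ennreal_mult)

lemma kernel_integrable_AE:
  fixes f :: "real \<Rightarrow> 'a::euclidean_space"
  assumes b: "0 < \<beta>" and f: "integrable M f"
  shows "AE t in M. integrable M (\<lambda>\<tau>. RL_kernel \<beta> (t - \<tau>) *\<^sub>R f \<tau>)"
  using kernel_nn_integrable_AE[OF assms]
proof eventually_elim
  case (elim t)
  with b f show ?case by (intro kernel_integrableI) auto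
qed

lemma RL_integral_integrable:
  fixes f :: "real \<Rightarrow> 'a::euclidean_space"
  assumes b: "0 < \<beta>" and f: "integrable M f"
  shows "integrable M (RL_integral \<beta> f)"
proof (rule integrableI_bounded)
  have [measurable]: "f \<in> borel_measurable M" using f by auto
  show [measurable]: "RL_integral \<beta> f \<in> borel_measurable M" by (rule RL_integral_measurable) measurable
  have "(\<integral>\<^sup>+ t. ennreal (norm (RL_integral \<beta> f t)) \<partial>M) \<le> ennreal (exp (1 * T)) * (\<integral>\<^sup>+ t. ennreal (exp (- (1 * t))) * ennreal (norm (RL_integral \<beta> f t)) \<partial>M)"
    by (intro exp_weight_lower) auto
  also have "\<dots> \<le> ennreal (exp (1 * T)) * (ennreal (1 powr - \<beta>) * (\<integral>\<^sup>+ t. ennreal (exp (- (1 * t))) * ennreal (norm (f t)) \<partial>M))"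
    using b by (intro mult_left_mono RL_integral_weighted_le) auto
  also have "\<dots> \<le> ennreal (exp (1 * T)) * (ennreal (1 powr - \<beta>) * (\<integral>\<^sup>+ t. ennreal (norm (f t)) \<partial>M))"
    by (intro mult_left_mono exp_weight_upper) auto
  also have "\<dots> < \<infinity>"
    using f by (auto simp: integrable_iff_bounded ennreal_mult_less_top)
  finally show "(\<integral>\<^sup>+ t. ennreal (norm (RL_integral \<beta> f t)) \<partial>M) < \<infinity>" .
qed

text \<open>Fubini and the convolution identity of the kernels. The hypothesis \<open>fin\<close> is
  absolute integrability of the double integral at this particular t, so the identity is pointwise;
  callers supply \<open>fin\<close> for the t at hand.\<close>

lemma RL_integral_semigroup:
  fixes f :: "real \<Rightarrow> 'a::euclidean_space"
  assumes b: "0 < \<beta>" and g: "0 < \<gamma>" and [measurable]: "f \<in> borel_measurable M" and t: "t \<in> {0..T}"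
    and fin: "(\<integral>\<^sup>+ \<tau>. ennreal (RL_kernel (\<beta> + \<gamma>) (t - \<tau>)) * ennreal (norm (f \<tau>)) \<partial>M) < \<infinity>"
  shows "RL_integral \<beta> (RL_integral \<gamma> f) t = RL_integral (\<beta> + \<gamma>) f t"
proof -
  let ?F = "\<lambda>r \<tau>. (RL_kernel \<beta> (t - r) * RL_kernel \<gamma> (r - \<tau>)) *\<^sub>R f \<tau>"
  have conv: "(\<integral>\<^sup>+ r. ennreal (RL_kernel \<beta> (t - r) * RL_kernel \<gamma> (r - \<tau>)) \<partial>M) = ennreal (RL_kernel (\<beta> + \<gamma>) (t - \<tau>))"
    if "\<tau> \<in> space M" for \<tau>
    using kernel_conv[OF b g, of t \<tau>] t that by simp
  have int: "integrable (M \<Otimes>\<^sub>M M) (case_prod ?F)"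
  proof (rule integrableI_bounded)
    show [measurable]: "case_prod ?F \<in> borel_measurable (M \<Otimes>\<^sub>M M)" by measurable
    have "(\<integral>\<^sup>+ x. ennreal (norm (case_prod ?F x)) \<partial>(M \<Otimes>\<^sub>M M)) = (\<integral>\<^sup>+ r. \<integral>\<^sup>+ \<tau>. ennreal (norm (?F r \<tau>)) \<partial>M \<partial>M)"
      by (subst M.nn_integral_fst[symmetric]) auto
    also have "\<dots> = (\<integral>\<^sup>+ \<tau>. \<integral>\<^sup>+ r. ennreal (norm (?F r \<tau>)) \<partial>M \<partial>M)"
      by (rule MM.Fubini'[symmetric]) measurable
    also have "\<dots> = (\<integral>\<^sup>+ \<tau>. \<integral>\<^sup>+ r. ennreal (RL_kernel \<beta> (t - r) * RL_kernel \<gamma> (r - \<tau>)) * ennreal (norm (f \<tau>)) \<partial>M \<partial>M)"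
      using b g by (intro nn_integral_cong) (auto simp: ennreal_mult abs_mult)
    also have "\<dots> = (\<integral>\<^sup>+ \<tau>. (\<integral>\<^sup>+ r. ennreal (RL_kernel \<beta> (t - r) * RL_kernel \<gamma> (r - \<tau>)) \<partial>M) * ennreal (norm (f \<tau>)) \<partial>M)"
      by (intro nn_integral_cong nn_integral_multc) measurable
    also have "\<dots> = (\<integral>\<^sup>+ \<tau>. ennreal (RL_kernel (\<beta> + \<gamma>) (t - \<tau>)) * ennreal (norm (f \<tau>)) \<partial>M)"
      by (intro nn_integral_cong) (simp only: conv)
    finally show "(\<integral>\<^sup>+ x. ennreal (norm (case_prod ?F x)) \<partial>(M \<Otimes>\<^sub>M M)) < \<infinity>"
      using fin by simp
  qed
  have conv': "(\<integral>r. RL_kernel \<beta> (t - r) * RL_kernel \<gamma> (r - \<tau>) \<partial>M) = RL_kernel (\<beta> + \<gamma>) (t - \<tau>)"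
    if "\<tau> \<in> space M" for \<tau>
    using conv[OF that] b g by (subst integral_eq_nn_integral) auto
  have "RL_integral \<beta> (RL_integral \<gamma> f) t = (\<integral>r. RL_kernel \<beta> (t - r) *\<^sub>R RL_integral \<gamma> f r \<partial>M)"
    by (rule RL_integral_eq[OF t])
  also have "\<dots> = (\<integral>r. \<integral>\<tau>. ?F r \<tau> \<partial>M \<partial>M)"
    by (intro Bochner_Integration.integral_cong refl)
       (simp add: RL_integral_eq integral_scaleR_right[symmetric] del: integral_scaleR_right)
  also have "\<dots> = (\<integral>\<tau>. \<integral>r. ?F r \<tau> \<partial>M \<partial>M)"
    by (rule MM.Fubini_integral[OF int, symmetric])
  also have "\<dots> = (\<integral>\<tau>. (\<integral>r. RL_kernel \<beta> (t - r) * RL_kernel \<gamma> (r - \<tau>) \<partial>M) *\<^sub>R f \<tau> \<partial>M)"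
    by (intro Bochner_Integration.integral_cong refl integral_scaleR_left)
       (use conv b g in \<open>auto intro!: integrableI_bounded\<close>)
  also have "\<dots> = (\<integral>\<tau>. RL_kernel (\<beta> + \<gamma>) (t - \<tau>) *\<^sub>R f \<tau> \<partial>M)"
    by (intro Bochner_Integration.integral_cong refl) (simp only: conv')
  also have "\<dots> = RL_integral (\<beta> + \<gamma>) f t"
    by (rule RL_integral_eq[OF t, symmetric])
  finally show ?thesis .
qed

text \<open>The semigroup law for the singular term, as if that term were the fractional integral of
  a point mass \<open>c\<close> at 0.\<close>

lemma RL_integral_kernel:
  fixes c :: "'a::euclidean_space"
  assumes b: "0 < \<beta>" and g: "0 < \<gamma>" and t: "t \<in> {0..T}"
  shows "RL_integral \<beta> (\<lambda>\<tau>. RL_kernel \<gamma> \<tau> *\<^sub>R c) t = RL_kernel (\<beta> + \<gamma>) t *\<^sub>R c"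
proof -
  have conv: "(\<integral>\<^sup>+ r. ennreal (RL_kernel \<beta> (t - r) * RL_kernel \<gamma> r) \<partial>M) = ennreal (RL_kernel (\<beta> + \<gamma>) t)"
    using kernel_conv[OF b g, of t 0] t by simp
  have [measurable]: "RL_kernel \<gamma> \<in> borel_measurable M" by measurable
  have "RL_integral \<beta> (\<lambda>\<tau>. RL_kernel \<gamma> \<tau> *\<^sub>R c) t = (\<integral>r. (RL_kernel \<beta> (t - r) * RL_kernel \<gamma> r) *\<^sub>R c \<partial>M)"
    unfolding RL_integral_eq[OF t] by simp
  also have "\<dots> = (\<integral>r. RL_kernel \<beta> (t - r) * RL_kernel \<gamma> r \<partial>M) *\<^sub>R c"
    by (intro integral_scaleR_left) (use conv b g in \<open>auto intro!: integrableI_bounded\<close>)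
  also have "(\<integral>r. RL_kernel \<beta> (t - r) * RL_kernel \<gamma> r \<partial>M) = RL_kernel (\<beta> + \<gamma>) t"
    using conv b g by (subst integral_eq_nn_integral) auto
  finally show ?thesis .
qed

section \<open>Lebesgue differentiation and absolute continuity\<close>

lemma RL_integral_one_eq_integral:
  fixes f :: "real \<Rightarrow> 'a::euclidean_space"
  assumes f: "integrable M f" and t: "t \<in> {0..T}"
  shows "RL_integral 1 f t = integral {0..t} f"
proof -
  have [measurable]: "f \<in> borel_measurable M" using f by auto
  have int: "integrable M (\<lambda>\<tau>. RL_kernel 1 (t - \<tau>) *\<^sub>R f \<tau>)"
    by (rule Bochner_Integration.integrable_bound[OF f]) (auto simp: RL_kernel_one)
  have "RL_integral 1 f t = integral {0..T} (\<lambda>\<tau>. RL_kernel 1 (t - \<tau>) *\<^sub>R f \<tau>)"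
    unfolding RL_integral_eq[OF t] using int by (intro lebesgue_integral_eq_integral) auto
  also have "\<dots> = integral {0..T} (\<lambda>\<tau>. if \<tau> \<in> {0..t} then f \<tau> else 0)"
    \<comment> \<open>The two integrands differ at \<tau> = t, where \<open>RL_kernel 1 0\<close> is
      0 but the closed interval contains t.\<close>
    by (rule integral_spike[of "{t}"]) (auto simp: RL_kernel_one)
  also have "\<dots> = integral {0..t} f"
    using t by (subst integral_restrict_Int) (simp add: Int_absorb2)
  finally show ?thesis .
qed

lemma RL_integral_one_diff:
  fixes f :: "real \<Rightarrow> 'a::euclidean_space"
  assumes f: "integrable M f" and t: "s \<in> {0..T}" "t \<in> {0..T}" "s \<le> t"
  shows "RL_integral 1 f t - RL_integral 1 f s = integral {s..t} f"
proof -
  have "f integrable_on {0..T}" using f by (rule integrable_on_lebesgue_on) simp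
  then have "f integrable_on {0..t}"
    by (rule integrable_on_subinterval) (use t in auto)
  then have "integral {0..s} f + integral {s..t} f = integral {0..t} f"
    using t by (intro Henstock_Kurzweil_Integration.integral_combine) auto
  then show ?thesis
    using f t by (simp add: RL_integral_one_eq_integral algebra_simps)
qed

lemma AE_M_I:
  assumes "negligible N" and "\<And>t. 0 \<le> t \<Longrightarrow> t \<le> T \<Longrightarrow> t \<notin> N \<Longrightarrow> P t"
  shows "AE t in M. P t"
proof -
  have "N \<in> null_sets lebesgue" using assms(1) by (simp add: negligible_iff_null_sets)
  then have "AE t in lebesgue. t \<notin> N" by (rule AE_not_in)
  then have "AE t in lebesgue. t \<in> {0..T} \<longrightarrow> P t"
    by eventually_elim (use assms(2) in auto)
  then show ?thesis by (simp add: AE_restrict_space_iff)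
qed

text \<open>The fact \<open>integrable_ccontinuous_explicit\<close> controls only the averages over
  [x, x + h]. Applied to the reflected function as well, it also controls the averages over
  [x - h, x], and the two together give a derivative within [0,T]. Extension of \<open>f\<close> by
  0 provides integrability on every interval.\<close>

lemma Lebesgue_differentiation:
  fixes f :: "real \<Rightarrow> 'a::euclidean_space"
  assumes f: "integrable M f"
  shows "AE t in M. (RL_integral 1 f has_vector_derivative f t) (at t within {0..T})"
proof -
  define g where "g = (\<lambda>x. if x \<in> {0..T} then f x else 0)"
  have "f integrable_on {0..T}" using f by (rule integrable_on_lebesgue_on) simp
  then have "g integrable_on UNIV"
    unfolding g_def by (subst integrable_restrict_UNIV)
  then have g: "g integrable_on cbox a b" for a b
    by (rule integrable_on_subcbox) simp
  have g': "(\<lambda>x. g (- x)) integrable_on cbox a b" for a b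
    using g[of "-b" "-a"] integrable_reflect[of g "-a" "-b"] by simp
  obtain N1 where N1: "negligible N1"
    "\<And>x e. x \<notin> N1 \<Longrightarrow> 0 < e \<Longrightarrow> \<exists>d>0. \<forall>h. 0 < h \<and> h < d \<longrightarrow>
        norm (integral (cbox x (x + h *\<^sub>R One)) g /\<^sub>R h ^ DIM(real) - g x) < e"
    using integrable_ccontinuous_explicit[OF g] by blast
  obtain N2 where N2: "negligible N2"
    "\<And>x e. x \<notin> N2 \<Longrightarrow> 0 < e \<Longrightarrow> \<exists>d>0. \<forall>h. 0 < h \<and> h < d \<longrightarrow>
        norm (integral (cbox x (x + h *\<^sub>R One)) (\<lambda>x. g (- x)) /\<^sub>R h ^ DIM(real) - g (- x)) < e"
    using integrable_ccontinuous_explicit[OF g'] by blast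
  have neg: "negligible (N1 \<union> uminus ` N2)"
    using N1(1) N2(1) by (intro negligible_Un negligible_differentiable_image_negligible) (auto intro!: derivative_intros simp: differentiable_on_minus)
  show ?thesis
  proof (rule AE_M_I[OF neg])
    fix x assume x: "0 \<le> x" "x \<le> T" "x \<notin> N1 \<union> uminus ` N2"
    then have nin: "x \<notin> N1" "- x \<notin> N2" by (auto simp: image_iff)
    have gx: "g x = f x" using x by (simp add: g_def)
    have incr: "RL_integral 1 f t - RL_integral 1 f s = integral {s..t} g"
      if "0 \<le> s" "s \<le> t" "t \<le> T" for s t
    proof -
      have "integral {s..t} g = integral {s..t} f"
        using that by (intro Henstock_Kurzweil_Integration.integral_cong) (auto simp: g_def)
      then show ?thesis using RL_integral_one_diff[OF f, of s t] that by simp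
    qed
    have "\<exists>d>0. \<forall>y\<in>{0..T}. norm (y - x) < d \<longrightarrow>
      norm (RL_integral 1 f y - RL_integral 1 f x - (y - x) *\<^sub>R f x) \<le> e * norm (y - x)" if e: "0 < e" for e
    proof -
      obtain d1 where d1: "0 < d1" "\<And>h. 0 < h \<Longrightarrow> h < d1 \<Longrightarrow> norm (integral {x..x + h} g /\<^sub>R h - f x) < e"
        using N1(2)[OF nin(1) e] gx by (auto simp: cbox_interval)
      obtain d2 where d2: "0 < d2" "\<And>h. 0 < h \<Longrightarrow> h < d2 \<Longrightarrow> norm (integral {-x..-x + h} (\<lambda>x. g (- x)) /\<^sub>R h - f x) < e"
        using N2(2)[OF nin(2) e] gx by (auto simp: cbox_interval)
      have scale: "norm (I - h *\<^sub>R f x) \<le> e * h" if "0 < h" "norm (I /\<^sub>R h - f x) < e" for I h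
      proof -
        have "I - h *\<^sub>R f x = h *\<^sub>R (I /\<^sub>R h - f x)"
          using that by (simp add: scaleR_diff_right)
        then have "norm (I - h *\<^sub>R f x) = h * norm (I /\<^sub>R h - f x)"
          using that by simp
        then show ?thesis using that by (simp add: mult.commute)
      qed
      show ?thesis
      proof (intro exI conjI ballI impI)
        show "0 < min d1 d2" using d1 d2 by simp
        fix y assume y: "y \<in> {0..T}" "norm (y - x) < min d1 d2"
        consider "y = x" | "x < y" | "y < x" by linarith
        then show "norm (RL_integral 1 f y - RL_integral 1 f x - (y - x) *\<^sub>R f x) \<le> e * norm (y - x)"
        proof cases
          case 2
          with y have "norm (integral {x..x + (y - x)} g /\<^sub>R (y - x) - f x) < e"
            by (intro d1) auto
          with 2 have "norm (integral {x..y} g - (y - x) *\<^sub>R f x) \<le> e * (y - x)"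
            by (intro scale) auto
          then show ?thesis using incr[of x y] x y 2 by simp
        next
          case 3
          with y have "norm (integral {-x..-x + (x - y)} (\<lambda>x. g (- x)) /\<^sub>R (x - y) - f x) < e"
            by (intro d2) auto
          moreover have "integral {-x..-y} (\<lambda>x. g (- x)) = integral {y..x} g"
            by (rule Henstock_Kurzweil_Integration.integral_reflect_real)
          ultimately have "norm (integral {y..x} g - (x - y) *\<^sub>R f x) \<le> e * (x - y)"
            using 3 by (intro scale) auto
          also have "integral {y..x} g - (x - y) *\<^sub>R f x = - (RL_integral 1 f y - RL_integral 1 f x - (y - x) *\<^sub>R f x)"
            using incr[of y x] x y 3 by (simp add: algebra_simps)
          finally show ?thesis using 3 by (simp add: norm_minus_commute)
        qed simp
      qed
    qed
    then show "(RL_integral 1 f has_vector_derivative f x) (at x within {0..T})"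
      unfolding has_vector_derivative_def has_derivative_within_alt
      by (auto intro: bounded_linear_scaleR_left)
  qed
qed

text \<open>Cut \<open>norm (f \<tau>)\<close> at a level n. The excess \<open>?h n\<close> has
  integral below e/2 for large n by dominated convergence, and the truncated part contributes at
  most n times the total length of the intervals.\<close>

lemma RL_integral_one_abs_continuous:
  fixes f :: "real \<Rightarrow> 'a::euclidean_space"
  assumes f: "integrable M f"
  shows "abs_continuous_on_interval 0 T (\<lambda>t. RL_integral 1 f t + c)"
  unfolding abs_continuous_on_interval_def
proof (intro allI impI)
  fix e :: real assume e: "0 < e"
  have [measurable]: "f \<in> borel_measurable M" using f by auto
  let ?h = "\<lambda>(n::nat) \<tau>. norm (f \<tau>) - min (norm (f \<tau>)) (real n)"
  have inth: "integrable M (?h n)" for n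
    by (rule Bochner_Integration.integrable_bound[OF integrable_norm[OF f]]) auto
  have "(\<lambda>n. \<integral>\<tau>. ?h n \<tau> \<partial>M) \<longlonglongrightarrow> (\<integral>\<tau>. 0 \<partial>M)"
  proof (rule integral_dominated_convergence[where w = "\<lambda>\<tau>. norm (f \<tau>)"])
    show "AE \<tau> in M. (\<lambda>n. ?h n \<tau>) \<longlonglongrightarrow> 0"
    proof (intro AE_I2 tendsto_eventually)
      fix \<tau>
      obtain n0 :: nat where "norm (f \<tau>) \<le> real n0" using real_arch_simple by blast
      then show "\<forall>\<^sub>F n in sequentially. ?h n \<tau> = 0"
        unfolding eventually_sequentially by (intro exI[of _ n0]) (auto simp: min_def)
    qed
  qed (use f in auto)
  then have "\<forall>\<^sub>F n in sequentially. (\<integral>\<tau>. ?h n \<tau> \<partial>M) < e / 2"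
    using e by (intro order_tendstoD) auto
  then obtain n :: nat where n: "(\<integral>\<tau>. ?h n \<tau> \<partial>M) < e / 2"
    by (auto simp: eventually_sequentially)
  show "\<exists>\<delta>>0. \<forall>(m::nat) l r.
        (\<forall>k<m. 0 \<le> l k \<and> l k \<le> r k \<and> r k \<le> T) \<and>
        disjoint_family_on (\<lambda>k. {l k<..<r k}) {..<m} \<and> (\<Sum>k<m. r k - l k) < \<delta> \<longrightarrow>
        (\<Sum>k<m. norm ((RL_integral 1 f (r k) + c) - (RL_integral 1 f (l k) + c))) < e"
  proof (intro exI conjI allI impI)
    \<comment> \<open>The summand 1 avoids a division by 0 when n = 0.\<close>
    show "0 < e / (2 * (real n + 1))" using e by simp
    fix m :: nat and l r
    assume "(\<forall>k<m. 0 \<le> l k \<and> l k \<le> r k \<and> r k \<le> T) \<and>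
        disjoint_family_on (\<lambda>k. {l k<..<r k}) {..<m} \<and> (\<Sum>k<m. r k - l k) < e / (2 * (real n + 1))"
    then have lr: "\<And>k. k < m \<Longrightarrow> 0 \<le> l k" "\<And>k. k < m \<Longrightarrow> l k \<le> r k" "\<And>k. k < m \<Longrightarrow> r k \<le> T"
      and disj: "disjoint_family_on (\<lambda>k. {l k<..<r k}) {..<m}"
      and small: "(\<Sum>k<m. r k - l k) < e / (2 * (real n + 1))" by auto
    let ?I = "\<lambda>k. indicator {l k..<r k} :: real \<Rightarrow> real"
    \<comment> \<open>Absolute continuity speaks of open intervals, but
      \<open>RL_kernel 1 (r k - \<tau>) - RL_kernel 1 (l k - \<tau>)\<close> is the indicator of a
      half-open one. A common point of two half-open intervals would have common points of the open
      ones immediately to its right.\<close>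
    have disj': "disjoint_family_on (\<lambda>k. {l k..<r k}) {..<m}"
      unfolding disjoint_family_on_def
    proof (intro ballI impI)
      fix j k assume jk: "j \<in> {..<m}" "k \<in> {..<m}" "j \<noteq> k"
      show "{l j..<r j} \<inter> {l k..<r k} = {}"
      proof (rule ccontr)
        assume "{l j..<r j} \<inter> {l k..<r k} \<noteq> {}"
        then obtain x where "x \<in> {l j..<r j}" "x \<in> {l k..<r k}" by blast
        then have "(x + min (r j) (r k)) / 2 \<in> {l j<..<r j} \<inter> {l k<..<r k}"
          by (auto simp: min_def)
        moreover have "{l j<..<r j} \<inter> {l k<..<r k} = {}"
          using disj jk unfolding disjoint_family_on_def by blast
        ultimately show False by blast
      qed
    qed
    have sumI: "(\<Sum>k<m. ?I k \<tau>) \<le> 1" for \<tau>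
    proof -
      have "(\<Sum>k<m. ?I k \<tau>) = indicator (\<Union>k<m. {l k..<r k}) \<tau>"
        using disj' by (intro indicator_UN_disjoint[symmetric]) auto
      then show ?thesis by (auto simp: indicator_def)
    qed
    have bound: "norm (RL_integral 1 f (r k) - RL_integral 1 f (l k)) \<le> (\<integral>\<tau>. ?I k \<tau> * ?h n \<tau> \<partial>M) + real n * (r k - l k)"
      if k: "k < m" for k
    proof -
      have tt: "r k \<in> {0..T}" "l k \<in> {0..T}" using lr[OF k] by auto
      have i: "integrable M (\<lambda>\<tau>. RL_kernel 1 (t - \<tau>) *\<^sub>R f \<tau>)" for t
        by (rule Bochner_Integration.integrable_bound[OF f]) (auto simp: RL_kernel_one)
      have ih: "integrable M (\<lambda>\<tau>. ?I k \<tau> * ?h n \<tau>)"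
        by (rule Bochner_Integration.integrable_bound[OF inth[of n]]) (auto simp: indicator_def)
      have ii: "integrable M (?I k)"
        by (rule Bochner_Integration.integrable_bound[of _ "\<lambda>_. 1::real"]) (auto simp: indicator_def)
      have "RL_integral 1 f (r k) - RL_integral 1 f (l k)
          = (\<integral>\<tau>. RL_kernel 1 (r k - \<tau>) *\<^sub>R f \<tau> - RL_kernel 1 (l k - \<tau>) *\<^sub>R f \<tau> \<partial>M)"
        unfolding RL_integral_eq[OF tt(1)] RL_integral_eq[OF tt(2)]
        by (intro Bochner_Integration.integral_diff[symmetric] i)
      then have "norm (RL_integral 1 f (r k) - RL_integral 1 f (l k))
          = norm (\<integral>\<tau>. RL_kernel 1 (r k - \<tau>) *\<^sub>R f \<tau> - RL_kernel 1 (l k - \<tau>) *\<^sub>R f \<tau> \<partial>M)"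
        by (rule arg_cong)
      also have "\<dots> \<le> (\<integral>\<tau>. ?I k \<tau> * ?h n \<tau> + real n * ?I k \<tau> \<partial>M)"
      proof (rule Bochner_Integration.integral_norm_bound_integral)
        show "norm (RL_kernel 1 (r k - \<tau>) *\<^sub>R f \<tau> - RL_kernel 1 (l k - \<tau>) *\<^sub>R f \<tau>) \<le> ?I k \<tau> * ?h n \<tau> + real n * ?I k \<tau>" for \<tau>
          using lr(2)[OF k] by (auto simp: RL_kernel_one indicator_def min_def)
      qed (use i ih ii in auto)
      also have "\<dots> = (\<integral>\<tau>. ?I k \<tau> * ?h n \<tau> \<partial>M) + real n * (\<integral>\<tau>. ?I k \<tau> \<partial>M)"
        using ih ii by simp
      also have "(\<integral>\<tau>. ?I k \<tau> \<partial>M) = r k - l k"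
      proof -
        have "(\<integral>\<tau>. ?I k \<tau> \<partial>M) = measure M ({l k..<r k} \<inter> space M)"
          by (rule Bochner_Integration.integral_indicator)
        also have "{l k..<r k} \<inter> space M = {l k..<r k}" using lr[OF k] by auto
        also have "measure M {l k..<r k} = r k - l k"
          using lr[OF k] by (subst measure_restrict_space) auto
        finally show ?thesis .
      qed
      finally show ?thesis .
    qed
    have ih: "integrable M (\<lambda>\<tau>. ?I k \<tau> * ?h n \<tau>)" for k
      by (rule Bochner_Integration.integrable_bound[OF inth[of n]]) (auto simp: indicator_def)
    have "(\<Sum>k<m. norm ((RL_integral 1 f (r k) + c) - (RL_integral 1 f (l k) + c)))
        \<le> (\<Sum>k<m. (\<integral>\<tau>. ?I k \<tau> * ?h n \<tau> \<partial>M) + real n * (r k - l k))"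
      using bound by (intro sum_mono) auto
    also have "\<dots> = (\<integral>\<tau>. (\<Sum>k<m. ?I k \<tau>) * ?h n \<tau> \<partial>M) + real n * (\<Sum>k<m. r k - l k)"
      unfolding sum_distrib_right using ih
      by (subst Bochner_Integration.integral_sum) (auto simp: sum.distrib sum_distrib_left)
    also have "(\<integral>\<tau>. (\<Sum>k<m. ?I k \<tau>) * ?h n \<tau> \<partial>M) \<le> (\<integral>\<tau>. ?h n \<tau> \<partial>M)"
    proof (rule Bochner_Integration.integral_mono)
      show "integrable M (\<lambda>\<tau>. (\<Sum>k<m. ?I k \<tau>) * ?h n \<tau>)"
        unfolding sum_distrib_right using ih by (intro Bochner_Integration.integrable_sum)
      show "(\<Sum>k<m. ?I k \<tau>) * ?h n \<tau> \<le> ?h n \<tau>" for \<tau>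
        using sumI[of \<tau>] by (intro mult_left_le_one_le) (auto intro: sum_nonneg)
    qed (rule inth)
    also have "(\<integral>\<tau>. ?h n \<tau> \<partial>M) < e / 2" by (rule n)
    also have "real n * (\<Sum>k<m. r k - l k) \<le> (real n + 1) * (e / (2 * (real n + 1)))"
      using small lr(2) by (intro mult_mono) (auto intro!: sum_nonneg)
    also have "\<dots> = e / 2" by (simp add: field_simps)
    finally show "(\<Sum>k<m. norm ((RL_integral 1 f (r k) + c) - (RL_integral 1 f (l k) + c))) < e"
      by simp
  qed
qed

section \<open>Uniqueness of the absolutely continuous representative\<close>

lemma abs_continuous_on_interval_imp_continuous:
  fixes F :: "real \<Rightarrow> 'a::euclidean_space"
  assumes F: "abs_continuous_on_interval a b F"
  shows "continuous_on {a..b} F"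
  unfolding continuous_on_iff
proof (intro ballI allI impI)
  fix x e :: real assume x: "x \<in> {a..b}" and e: "0 < e"
  obtain d where d: "0 < d" and
    D: "\<forall>(n::nat) l r. (\<forall>k<n. a \<le> l k \<and> l k \<le> r k \<and> r k \<le> b) \<and> disjoint_family_on (\<lambda>k. {l k<..<r k}) {..<n} \<and>
      (\<Sum>k<n. r k - l k) < d \<longrightarrow> (\<Sum>k<n. norm (F (r k) - F (l k))) < e"
    using F[unfolded abs_continuous_on_interval_def, THEN spec, THEN mp, OF e] by (elim exE conjE)
  \<comment> \<open>For a family of one interval the definition reduces to uniform
    continuity.\<close>
  have step: "norm (F v - F u) < e" if "a \<le> u" "u \<le> v" "v \<le> b" "v - u < d" for u v
    using D[THEN spec, THEN spec, THEN spec, of "Suc 0" "\<lambda>_. u" "\<lambda>_. v"] that by (simp add: disjoint_family_on_def)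
  show "\<exists>d>0. \<forall>x'\<in>{a..b}. dist x' x < d \<longrightarrow> dist (F x') (F x) < e"
  proof (intro exI[of _ d] conjI d ballI impI)
    fix y assume y: "y \<in> {a..b}" "dist y x < d"
    show "dist (F y) (F x) < e"
    proof (cases "x \<le> y")
      case True
      then show ?thesis using step[of x y] x y by (auto simp: dist_norm)
    next
      case False
      then show ?thesis using step[of y x] x y by (auto simp: dist_norm norm_minus_commute)
    qed
  qed
qed

text \<open>If the functions differed at t, they would differ on a neighbourhood of t in [0,T].
  Clipped to (0,T) it still contains a nonempty open interval because T > 0, even when t is an
  endpoint, and such an interval is not negligible.\<close>

lemma continuous_AE_eq_imp_eq:
  fixes F G :: "real \<Rightarrow> 'a::euclidean_space"
  assumes F: "continuous_on {0..T} F" and G: "continuous_on {0..T} G"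
    and ae: "AE t in M. F t = G t" and t: "t \<in> {0..T}"
  shows "F t = G t"
proof (rule ccontr)
  assume ne: "F t \<noteq> G t"
  have "AE t in lebesgue. t \<in> {0..T} \<longrightarrow> F t = G t"
    using ae by (simp add: AE_restrict_space_iff)
  then obtain N where N: "N \<in> null_sets lebesgue" "{s. \<not> (s \<in> {0..T} \<longrightarrow> F s = G s)} \<subseteq> N"
    by (auto simp: eventually_ae_filter)
  have neg: "negligible N" using N(1) by (simp add: negligible_iff_null_sets)
  have "continuous_on {0..T} (\<lambda>t. norm (F t - G t))"
    using F G by (intro continuous_intros)
  then obtain d where d: "0 < d" "\<And>s. s \<in> {0..T} \<Longrightarrow> dist s t < d \<Longrightarrow>
      dist (norm (F s - G s)) (norm (F t - G t)) < norm (F t - G t)"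
    using t ne unfolding continuous_on_iff by (metis right_minus_eq zero_less_norm_iff)
  have "{max 0 (t - d)<..<min T (t + d)} \<subseteq> N"
  proof
    fix s assume s: "s \<in> {max 0 (t - d)<..<min T (t + d)}"
    then have "dist (norm (F s - G s)) (norm (F t - G t)) < norm (F t - G t)"
      by (intro d(2)) (auto simp: dist_real_def)
    then have "F s \<noteq> G s" by (auto simp: dist_real_def)
    then show "s \<in> N" using N(2) s by auto
  qed
  then have "negligible {max 0 (t - d)<..<min T (t + d)}"
    by (rule negligible_subset[OF neg])
  then have "{max 0 (t - d)<..<min T (t + d)} = {}"
    using negligible_interval(2)[of "max 0 (t - d)" "min T (t + d)"] by (simp add: box_real)
  moreover have "max 0 (t - d) < min T (t + d)" using t d(1) T_pos by auto
  ultimately show False by auto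
qed

end

lemma abs_continuous_on_interval_cong:
  assumes "\<And>t. a \<le> t \<Longrightarrow> t \<le> b \<Longrightarrow> F t = G t"
  shows "abs_continuous_on_interval a b F \<longleftrightarrow> abs_continuous_on_interval a b G"
proof -
  have "abs_continuous_on_interval a b G"
    if F: "abs_continuous_on_interval a b F" and eq: "\<And>t. a \<le> t \<Longrightarrow> t \<le> b \<Longrightarrow> F t = G t" for F G :: "real \<Rightarrow> 'a"
    unfolding abs_continuous_on_interval_def
  proof (intro allI impI)
    fix e :: real assume "0 < e"
    from F[unfolded abs_continuous_on_interval_def, THEN spec, THEN mp, OF this]
    obtain d where d: "0 < d" and
      D: "\<forall>(n::nat) l r. (\<forall>k<n. a \<le> l k \<and> l k \<le> r k \<and> r k \<le> b) \<and> disjoint_family_on (\<lambda>k. {l k<..<r k}) {..<n} \<and>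
      (\<Sum>k<n. r k - l k) < d \<longrightarrow> (\<Sum>k<n. norm (F (r k) - F (l k))) < e"
      by (elim exE conjE)
    show "\<exists>\<delta>>0. \<forall>(n::nat) l r. (\<forall>k<n. a \<le> l k \<and> l k \<le> r k \<and> r k \<le> b) \<and> disjoint_family_on (\<lambda>k. {l k<..<r k}) {..<n} \<and>
      (\<Sum>k<n. r k - l k) < \<delta> \<longrightarrow> (\<Sum>k<n. norm (G (r k) - G (l k))) < e"
    proof (intro exI[of _ d] conjI d allI impI)
      fix n :: nat and l r
      assume *: "(\<forall>k<n. a \<le> l k \<and> l k \<le> r k \<and> r k \<le> b) \<and> disjoint_family_on (\<lambda>k. {l k<..<r k}) {..<n} \<and>
        (\<Sum>k<n. r k - l k) < d"
      have "(\<Sum>k<n. norm (G (r k) - G (l k))) = (\<Sum>k<n. norm (F (r k) - F (l k)))"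
      proof (intro sum.cong refl)
        fix k assume "k \<in> {..<n}"
        then have "a \<le> l k" "l k \<le> r k" "r k \<le> b" using * by auto
        then show "norm (G (r k) - G (l k)) = norm (F (r k) - F (l k))"
          using eq[of "r k"] eq[of "l k"] by simp
      qed
      also have "\<dots> < e" using D[THEN spec, THEN spec, THEN spec, THEN mp, OF *] .
      finally show "(\<Sum>k<n. norm (G (r k) - G (l k))) < e" .
    qed
  qed
  from this[of F G] this[of G F] assms show ?thesis by auto
qed

context horizon
begin

section \<open>Admissibility as an integral equation\<close>

lemma AE_M_pos: "AE t in M. 0 < t"
  by (rule AE_M_I[of "{0}"]) auto

lemma RL_kernel_integrable:
  fixes c :: "'a::euclidean_space"
  assumes b: "0 < \<beta>"
  shows "integrable M (\<lambda>t. RL_kernel \<beta> t *\<^sub>R c)"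
proof -
  have [measurable]: "RL_kernel \<beta> \<in> borel_measurable M" by measurable
  have "(\<integral>\<^sup>+ t. ennreal (RL_kernel \<beta> t) \<partial>M) \<le> ennreal (exp (1 * T)) * (\<integral>\<^sup>+ t. ennreal (exp (- (1 * t))) * ennreal (RL_kernel \<beta> t) \<partial>M)"
    by (intro exp_weight_lower) auto
  also have "\<dots> \<le> ennreal (exp (1 * T)) * ennreal (1 powr - \<beta>)"
    using kernel_exp_le[OF b, of 1 0] b by (intro mult_left_mono) (auto simp: ennreal_mult)
  also have "\<dots> < \<infinity>" by (simp add: ennreal_mult[symmetric])
  finally have "integrable M (RL_kernel \<beta>)"
    using b by (intro integrableI_bounded) auto
  then show ?thesis by simp
qed

lemma RL_integral_add:
  fixes f g :: "real \<Rightarrow> 'a::euclidean_space"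
  assumes t: "t \<in> {0..T}"
    and "integrable M (\<lambda>\<tau>. RL_kernel \<beta> (t - \<tau>) *\<^sub>R f \<tau>)" "integrable M (\<lambda>\<tau>. RL_kernel \<beta> (t - \<tau>) *\<^sub>R g \<tau>)"
  shows "RL_integral \<beta> (\<lambda>\<tau>. f \<tau> + g \<tau>) t = RL_integral \<beta> f t + RL_integral \<beta> g t"
  using assms by (simp add: RL_integral_eq scaleR_add_right)

lemma RL_integral_bounded_linear:
  fixes f :: "real \<Rightarrow> 'a::euclidean_space" and h :: "'a \<Rightarrow> 'b::euclidean_space"
  assumes t: "t \<in> {0..T}" and h: "bounded_linear h"
    and "integrable M (\<lambda>\<tau>. RL_kernel \<beta> (t - \<tau>) *\<^sub>R f \<tau>)"
  shows "RL_integral \<beta> (\<lambda>\<tau>. h (f \<tau>)) t = h (RL_integral \<beta> f t)"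
  using integral_bounded_linear[OF h assms(3)] t
  by (simp add: RL_integral_eq linear_cmul[OF bounded_linear.linear[OF h]])

text \<open>The orders 1 - \<alpha> and \<alpha> add up to 1, so the semigroup law yields I^1 g,
  while the singular term becomes \<open>RL_kernel 1 t *\<^sub>R c\<close>, which is
  \<open>c\<close> for t > 0. The fractional integral of a state thus agrees almost everywhere with
  an absolutely continuous function.\<close>

lemma RL_integral_complementary:
  fixes f g :: "real \<Rightarrow> 'a::euclidean_space"
  assumes \<alpha>: "0 < \<alpha>" "\<alpha> < 1" and f [measurable]: "f \<in> borel_measurable M" and g: "integrable M g"
    and ae: "AE t in M. f t = RL_integral \<alpha> g t + RL_kernel \<alpha> t *\<^sub>R c"
  shows "AE t in M. RL_integral (1 - \<alpha>) f t = RL_integral 1 g t + c"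
proof -
  have [measurable]: "g \<in> borel_measurable M" using g by auto
  have Ig: "integrable M (RL_integral \<alpha> g)" using \<alpha> g by (intro RL_integral_integrable) auto
  then have [measurable]: "RL_integral \<alpha> g \<in> borel_measurable M" by auto
  have kc: "integrable M (\<lambda>t. RL_kernel \<alpha> t *\<^sub>R c)" using \<alpha> by (intro RL_kernel_integrable)
  then have [measurable]: "(\<lambda>t. RL_kernel \<alpha> t *\<^sub>R c) \<in> borel_measurable M" by auto
  have 1: "AE t in M. integrable M (\<lambda>\<tau>. RL_kernel (1 - \<alpha>) (t - \<tau>) *\<^sub>R RL_integral \<alpha> g \<tau>)"
    using \<alpha> Ig by (intro kernel_integrable_AE) auto
  have 2: "AE t in M. integrable M (\<lambda>\<tau>. RL_kernel (1 - \<alpha>) (t - \<tau>) *\<^sub>R (RL_kernel \<alpha> \<tau> *\<^sub>R c))"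
    using \<alpha> kc by (intro kernel_integrable_AE) auto
  show ?thesis
    using 1 2 AE_M_pos AE_space
  proof eventually_elim
    case (elim t)
    then have t: "t \<in> {0..T}" "0 < t" by auto
    have "RL_integral (1 - \<alpha>) f t = RL_integral (1 - \<alpha>) (\<lambda>t. RL_integral \<alpha> g t + RL_kernel \<alpha> t *\<^sub>R c) t"
      by (rule RL_integral_cong_AE[OF _ _ ae t(1)]) auto
    also have "\<dots> = RL_integral (1 - \<alpha>) (RL_integral \<alpha> g) t + RL_integral (1 - \<alpha>) (\<lambda>t. RL_kernel \<alpha> t *\<^sub>R c) t"
      using elim t by (intro RL_integral_add) auto
    also have "RL_integral (1 - \<alpha>) (\<lambda>t. RL_kernel \<alpha> t *\<^sub>R c) t = c"
      using \<alpha> t by (subst RL_integral_kernel) (auto simp: RL_kernel_one)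
    also have "RL_integral (1 - \<alpha>) (RL_integral \<alpha> g) t = RL_integral (1 - \<alpha> + \<alpha>) g t"
    proof (rule RL_integral_semigroup)
      have "(\<integral>\<^sup>+ \<tau>. ennreal (RL_kernel (1 - \<alpha> + \<alpha>) (t - \<tau>)) * ennreal (norm (g \<tau>)) \<partial>M) \<le> (\<integral>\<^sup>+ \<tau>. ennreal (norm (g \<tau>)) \<partial>M)"
        by (intro nn_integral_mono) (auto simp: RL_kernel_one)
      also have "\<dots> < \<infinity>" using g by (auto simp: integrable_iff_bounded)
      finally show "(\<integral>\<^sup>+ \<tau>. ennreal (RL_kernel (1 - \<alpha> + \<alpha>) (t - \<tau>)) * ennreal (norm (g \<tau>)) \<partial>M) < \<infinity>" .
    qed (use \<alpha> t in auto)
    finally show ?case by simp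
  qed
qed

text \<open>Continuity upgrades equality almost everywhere to equality on [0,T]. Once the
  representative is known to be I^1 g + c, its derivative \<open>g\<close> and its initial value
  \<open>c\<close> can be read off, as the next two lemmas do.\<close>

lemma RL_AC_rep_iff:
  fixes f g :: "real \<Rightarrow> 'a::euclidean_space"
  assumes "0 < \<alpha>" "\<alpha> < 1" "f \<in> borel_measurable M" and g: "integrable M g"
    and "AE t in M. f t = RL_integral \<alpha> g t + RL_kernel \<alpha> t *\<^sub>R c"
  shows "RL_AC_rep \<alpha> T f F \<longleftrightarrow> (\<forall>t\<in>{0..T}. F t = RL_integral 1 g t + c)"
proof -
  note ae = RL_integral_complementary[OF assms]
  note ac = RL_integral_one_abs_continuous[OF g, of c]
  show ?thesis
  proof
    assume F: "RL_AC_rep \<alpha> T f F"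
    then have "AE t in M. F t = RL_integral (1 - \<alpha>) f t" by (simp add: RL_AC_rep_def)
    then have "AE t in M. F t = RL_integral 1 g t + c"
      using ae by eventually_elim simp
    then show "\<forall>t\<in>{0..T}. F t = RL_integral 1 g t + c"
      using F ac
      by (auto intro!: continuous_AE_eq_imp_eq[of F "\<lambda>t. RL_integral 1 g t + c"] abs_continuous_on_interval_imp_continuous simp: RL_AC_rep_def)
  next
    assume F: "\<forall>t\<in>{0..T}. F t = RL_integral 1 g t + c"
    then have "abs_continuous_on_interval 0 T F"
      using ac abs_continuous_on_interval_cong[of 0 T F "\<lambda>t. RL_integral 1 g t + c"] by auto
    moreover have "AE t in M. F t = RL_integral (1 - \<alpha>) f t"
      using ae AE_space by eventually_elim (use F in auto)
    ultimately show "RL_AC_rep \<alpha> T f F" by (simp add: RL_AC_rep_def)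
  qed
qed

lemma has_RL_derivative_iff:
  fixes f g :: "real \<Rightarrow> 'a::euclidean_space"
  assumes "0 < \<alpha>" "\<alpha> < 1" "f \<in> borel_measurable M" and g: "integrable M g"
    and "AE t in M. f t = RL_integral \<alpha> g t + RL_kernel \<alpha> t *\<^sub>R c"
  shows "has_RL_derivative \<alpha> T f h \<longleftrightarrow> (AE t in M. h t = g t)"
proof -
  note rep = RL_AC_rep_iff[OF assms]
  let ?F = "\<lambda>t. RL_integral 1 g t + c"
  have deriv: "AE t in M. (?F has_vector_derivative g t) (at t within {0..T})"
    using Lebesgue_differentiation[OF g]
    by eventually_elim (auto intro!: derivative_eq_intros)
  show ?thesis
  proof
    assume "has_RL_derivative \<alpha> T f h"
    then obtain F where F: "\<forall>t\<in>{0..T}. F t = ?F t"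
      "AE t in M. (F has_vector_derivative h t) (at t within {0..T})"
      unfolding has_RL_derivative_def rep by blast
    show "AE t in M. h t = g t"
      using F(2) deriv AE_space
    proof eventually_elim
      case (elim t)
      then have "(?F has_vector_derivative h t) (at t within {0..T})"
        using F(1) by (intro has_vector_derivative_transform[of t "{0..T}" ?F F]) auto
      with elim T_pos show ?case
        using vector_derivative_unique_within_closed_interval[of 0 T t ?F "h t" "g t"] by (simp add: cbox_interval)
    qed
  next
    assume "AE t in M. h t = g t"
    with deriv have "AE t in M. (?F has_vector_derivative h t) (at t within {0..T})"
      by eventually_elim simp
    then show "has_RL_derivative \<alpha> T f h"
      unfolding has_RL_derivative_def rep by (intro exI[of _ ?F]) auto
  qed
qed

lemma has_RL_initial_value_iff:
  fixes f g :: "real \<Rightarrow> 'a::euclidean_space"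
  assumes "0 < \<alpha>" "\<alpha> < 1" "f \<in> borel_measurable M" and g: "integrable M g"
    and "AE t in M. f t = RL_integral \<alpha> g t + RL_kernel \<alpha> t *\<^sub>R c"
  shows "has_RL_initial_value \<alpha> T f y \<longleftrightarrow> y = c"
proof -
  have "RL_integral 1 g 0 = (\<integral>\<tau>. RL_kernel 1 (0 - \<tau>) *\<^sub>R g \<tau> \<partial>M)"
    using T_pos by (intro RL_integral_eq) auto
  also have "\<dots> = (\<integral>\<tau>. 0 \<partial>M)"
    by (rule Bochner_Integration.integral_cong) (auto simp: RL_kernel_def)
  finally have 0: "RL_integral 1 g 0 = 0" by simp
  show ?thesis
  proof
    assume "has_RL_initial_value \<alpha> T f y"
    then show "y = c"
      unfolding has_RL_initial_value_def RL_AC_rep_iff[OF assms] using 0 T_pos by auto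
  next
    assume "y = c"
    then show "has_RL_initial_value \<alpha> T f y"
      unfolding has_RL_initial_value_def RL_AC_rep_iff[OF assms] using 0
      by (intro exI[of _ "\<lambda>t. RL_integral 1 g t + c"]) auto
  qed
qed

lemma Lp_space_integrable:
  fixes f :: "real \<Rightarrow> 'a::euclidean_space"
  assumes p: "1 \<le> p" and f: "f \<in> Lp_space p T"
  shows "integrable M f"
proof -
  have i: "integrable M (\<lambda>t. 1 + norm (f t) powr p)" and [measurable]: "f \<in> borel_measurable M"
    using f by (auto simp: Lp_space_def)
  have "norm v \<le> 1 + norm v powr p" for v :: 'a
  proof (cases "norm v \<le> 1")
    case False
    then have "norm v powr 1 \<le> norm v powr p" using p by (intro powr_mono) auto
    then show ?thesis using False by simp
  qed (simp add: add_increasing2)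
  then show ?thesis
    using i by (intro Bochner_Integration.integrable_bound[OF i]) (auto intro: AE_I2)
qed

text \<open>This rests on completeness of Lebesgue measure. States are prescribed only up to null
  sets, so their measurability has to be recovered from a representative.\<close>

lemma borel_measurable_AE_M:
  fixes f g :: "real \<Rightarrow> 'a::euclidean_space"
  assumes "f \<in> borel_measurable M" "AE t in M. f t = g t"
  shows "g \<in> borel_measurable M"
proof -
  have "AE t in lebesgue. t \<in> {0..T} \<longrightarrow> f t = g t"
    using assms(2) by (simp add: AE_restrict_space_iff)
  then have ae: "AE t in lebesgue. (if t \<in> {0..T} then f t else 0) = (if t \<in> {0..T} then g t else 0)"
    by eventually_elim auto
  have "(\<lambda>t. if t \<in> {0..T} then f t else 0) \<in> borel_measurable lebesgue"
    using assms(1) by (subst borel_measurable_if) auto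
  then have "(\<lambda>t. if t \<in> {0..T} then g t else 0) \<in> borel_measurable lebesgue"
    using ae by (rule borel_measurable_AE)
  then show ?thesis by (subst (asm) borel_measurable_if) auto
qed

lemma state_space_iff:
  assumes \<alpha>: "0 < \<alpha>"
  shows "x \<in> state_space \<alpha> p T \<longleftrightarrow>
    (\<exists>g\<in>Lp_space p T. \<exists>c. AE t in M. x t = RL_integral \<alpha> g t + RL_kernel \<alpha> t *\<^sub>R c)"
proof
  assume "x \<in> state_space \<alpha> p T"
  then obtain y g c where g: "g \<in> Lp_space p T" and y: "AE t in M. y t = RL_integral \<alpha> g t"
    and x: "AE t in M. x t = y t + c /\<^sub>R t powr (1 - \<alpha>)"
    by (auto simp: state_space_def RL_integral_Lp_def)
  \<comment> \<open>The two normalisations of the singular term differ by the factor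
    \<open>Gamma \<alpha>\<close>.\<close>
  have "AE t in M. x t = RL_integral \<alpha> g t + RL_kernel \<alpha> t *\<^sub>R (Gamma \<alpha> *\<^sub>R c)"
    using y x AE_M_pos
  proof eventually_elim
    case (elim t)
    have "Gamma \<alpha> \<noteq> 0" using \<alpha> by (metis Gamma_real_pos less_irrefl)
    with elim show ?case by (simp add: RL_kernel_def powr_minus[symmetric])
  qed
  with g show "\<exists>g\<in>Lp_space p T. \<exists>c. AE t in M. x t = RL_integral \<alpha> g t + RL_kernel \<alpha> t *\<^sub>R c"
    by blast
next
  assume "\<exists>g\<in>Lp_space p T. \<exists>c. AE t in M. x t = RL_integral \<alpha> g t + RL_kernel \<alpha> t *\<^sub>R c"
  then obtain g c where g: "g \<in> Lp_space p T"
    and x: "AE t in M. x t = RL_integral \<alpha> g t + RL_kernel \<alpha> t *\<^sub>R c" by blast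
  have "AE t in M. x t = RL_integral \<alpha> g t + (c /\<^sub>R Gamma \<alpha>) /\<^sub>R t powr (1 - \<alpha>)"
    using x AE_M_pos
    by eventually_elim (simp add: RL_kernel_def powr_minus[symmetric] divide_inverse mult.commute)
  moreover have "RL_integral \<alpha> g \<in> RL_integral_Lp \<alpha> p T"
    using g by (auto simp: RL_integral_Lp_def)
  ultimately show "x \<in> state_space \<alpha> p T"
    unfolding state_space_def by blast
qed

end

text \<open>The operator L of the system D x = L x + B u, where B is \<open>axis None\<close>. The
  component \<open>None\<close> is 0, as the leader is driven by the control alone.\<close>

definition HK_drift :: "('n::finite \<Rightarrow> 'n \<Rightarrow> real) \<Rightarrow> ('n \<Rightarrow> real) \<Rightarrow> (real^'d)^('n option) \<Rightarrow> (real^'d)^('n option)" where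
  "HK_drift a c x = (\<chi> k. case k of None \<Rightarrow> 0
     | Some i \<Rightarrow> (\<Sum>j\<in>UNIV. a i j *\<^sub>R (x $ Some j - x $ Some i)) + c i *\<^sub>R (x $ None - x $ Some i))"

lemma linear_HK_drift: "linear (HK_drift a c)"
proof (rule linearI)
  show "HK_drift a c (x + y) = HK_drift a c x + HK_drift a c y" for x y
    by (auto simp: HK_drift_def vec_eq_iff algebra_simps sum.distrib sum_subtractf split: option.splits)
  show "HK_drift a c (r *\<^sub>R x) = r *\<^sub>R HK_drift a c x" for r x
    by (auto simp: HK_drift_def vec_eq_iff sum_distrib_left scaleR_sum_right algebra_simps split: option.splits)
qed

lemma linear_axis: "linear (axis k :: 'a::real_vector \<Rightarrow> 'a^'n::finite)"
  by (rule linearI) (auto simp: axis_def vec_eq_iff)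

section \<open>Reduction of the control system to a Volterra equation\<close>

context horizon
begin

text \<open>A state has the form I^\<alpha> g plus a singular term with coefficient
  \<open>b\<close>; its derivative is \<open>g\<close> and its initial value is \<open>b\<close>.
  The system therefore says exactly that g = L x + B u almost everywhere and that \<open>b\<close>
  is \<open>xinit\<close>. Conversely, L x + B u itself serves as \<open>g\<close>.\<close>

lemma HK_admissible_iff:
  fixes xinit :: "(real^'d)^('n::finite option)"
  assumes \<alpha>: "0 < \<alpha>" "\<alpha> < 1" and p: "1 \<le> p"
  shows "(x, u) \<in> HK_admissible \<alpha> p T K a c xinit \<longleftrightarrow>
    u \<in> control_set K T \<and> x \<in> borel_measurable M \<and>
    (\<lambda>t. HK_drift a c (x t) + axis None (u t)) \<in> Lp_space p T \<and>
    (AE t in M. x t = RL_integral \<alpha> (\<lambda>\<tau>. HK_drift a c (x \<tau>) + axis None (u \<tau>)) t + RL_kernel \<alpha> t *\<^sub>R xinit)"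
    (is "?L \<longleftrightarrow> ?R")
proof -
  let ?h = "\<lambda>t. HK_drift a c (x t) + axis None (u t)"
  have key: "(has_RL_derivative \<alpha> T (\<lambda>t. x t $ None) u \<and>
        (\<forall>i. has_RL_derivative \<alpha> T (\<lambda>t. x t $ Some i)
           (\<lambda>t. (\<Sum>j\<in>UNIV. a i j *\<^sub>R (x t $ Some j - x t $ Some i))
                 + c i *\<^sub>R (x t $ None - x t $ Some i))) \<and>
        (\<forall>k. has_RL_initial_value \<alpha> T (\<lambda>t. x t $ k) (xinit $ k))) \<longleftrightarrow>
      ((AE t in M. ?h t = g t) \<and> xinit = b)"
    if g: "integrable M g" and x: "AE t in M. x t = RL_integral \<alpha> g t + RL_kernel \<alpha> t *\<^sub>R b" and mx: "x \<in> borel_measurable M" for g b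
  proof -
    \<comment> \<open>The component is pulled out of the integral at those t where the kernel
      integral of \<open>g\<close> converges, which is almost every t.\<close>
    have xk: "AE t in M. x t $ k = RL_integral \<alpha> (\<lambda>\<tau>. g \<tau> $ k) t + RL_kernel \<alpha> t *\<^sub>R (b $ k)" for k
      using kernel_integrable_AE[OF \<alpha>(1) g] x AE_space
    proof eventually_elim
      case (elim t)
      then show ?case
        using RL_integral_bounded_linear[of t "\<lambda>v. v $ k" \<alpha> g] by (simp add: bounded_linear_vec_nth)
    qed
    have mk: "(\<lambda>t. x t $ k) \<in> borel_measurable M" for k
      by (rule measurable_compose[OF mx borel_measurable_continuous_onI]) (intro continuous_intros)
    have gk: "integrable M (\<lambda>\<tau>. g \<tau> $ k)" for k
      by (rule integrable_bounded_linear[OF bounded_linear_vec_nth g])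
    note d = has_RL_derivative_iff[OF \<alpha> mk gk xk] and i = has_RL_initial_value_iff[OF \<alpha> mk gk xk]
    have h: "(AE t in M. ?h t = g t) \<longleftrightarrow> (\<forall>k. AE t in M. ?h t $ k = g t $ k)"
      by (simp add: vec_eq_iff AE_all_countable)
    have N: "?h t $ None = u t" for t
      by (simp add: HK_drift_def axis_def)
    have S: "?h t $ Some i = (\<Sum>j\<in>UNIV. a i j *\<^sub>R (x t $ Some j - x t $ Some i)) + c i *\<^sub>R (x t $ None - x t $ Some i)" for t i
      by (simp add: HK_drift_def axis_def)
    show ?thesis
      unfolding d i h vec_eq_iff[of xinit b] split_option_all[of "\<lambda>k. AE t in M. ?h t $ k = g t $ k"] N S by blast
  qed
  show ?thesis
  proof
    assume L: ?L
    then have xs: "x \<in> state_space \<alpha> p T" and u: "u \<in> control_set K T"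
      by (auto simp: HK_admissible_def)
    obtain g b where g: "g \<in> Lp_space p T" and x: "AE t in M. x t = RL_integral \<alpha> g t + RL_kernel \<alpha> t *\<^sub>R b"
      using xs unfolding state_space_iff[OF \<alpha>(1)] by blast
    have gi: "integrable M g" using Lp_space_integrable[OF p g] .
    have mk: "RL_kernel \<alpha> \<in> borel_measurable M" by measurable
    have "(\<lambda>t. RL_integral \<alpha> g t + RL_kernel \<alpha> t *\<^sub>R b) \<in> borel_measurable M"
      using gi mk by (intro borel_measurable_add RL_integral_measurable borel_measurable_scaleR) auto
    then have mx: "x \<in> borel_measurable M"
      by (rule borel_measurable_AE_M) (use x in \<open>eventually_elim, simp\<close>)
    have hg: "AE t in M. ?h t = g t" and b: "xinit = b"
      using L key[OF gi x mx] by (auto simp: HK_admissible_def)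
    have mh: "?h \<in> borel_measurable M"
      by (rule borel_measurable_AE_M[of g]) (use gi hg in \<open>auto elim!: eventually_mono\<close>)
    have "(\<lambda>t. norm (?h t) powr p) \<in> borel_measurable M"
      using mh by measurable
    then have "integrable M (\<lambda>t. norm (?h t) powr p)"
      using g hg by (subst integrable_cong_AE[where g = "\<lambda>t. norm (g t) powr p"]) (auto simp: Lp_space_def elim!: eventually_mono)
    with mh have hL: "?h \<in> Lp_space p T" by (simp add: Lp_space_def)
    have "AE t in M. x t = RL_integral \<alpha> ?h t + RL_kernel \<alpha> t *\<^sub>R xinit"
      using x AE_space
    proof eventually_elim
      case (elim t)
      then show ?case using RL_integral_cong_AE[OF mh _ hg, of t \<alpha>] gi b by auto
    qed
    with hL mx u show ?R by simp
  next
    assume R: ?R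
    then have i: "integrable M ?h" using Lp_space_integrable[OF p] by blast
    have "x \<in> state_space \<alpha> p T"
      unfolding state_space_iff[OF \<alpha>(1)] using R by blast
    moreover have "has_RL_derivative \<alpha> T (\<lambda>t. x t $ None) u \<and>
        (\<forall>i. has_RL_derivative \<alpha> T (\<lambda>t. x t $ Some i)
           (\<lambda>t. (\<Sum>j\<in>UNIV. a i j *\<^sub>R (x t $ Some j - x t $ Some i))
                 + c i *\<^sub>R (x t $ None - x t $ Some i))) \<and>
        (\<forall>k. has_RL_initial_value \<alpha> T (\<lambda>t. x t $ k) (xinit $ k))"
      using R key[OF i, of xinit] by simp
    ultimately show ?L using R by (simp add: HK_admissible_def)
  qed
qed

end

section \<open>Linear Volterra equations\<close>

text \<open>For x \<ge> 1 keep only the part t \<ge> R of Euler's integral, where t^(x - 1) \<ge>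
  R^(x - 1). As R is free, Gamma outgrows every geometric sequence, which is the form needed for the
  Picard series.\<close>

lemma Gamma_real_lower_bound:
  fixes x R :: real
  assumes x: "0 < x" and R: "1 \<le> R"
  shows "R powr (x - 1) * exp (- R) \<le> Gamma x"
proof -
  have ge1: "R powr (x - 1) * exp (- R) \<le> Gamma x" if x: "1 \<le> x" for x
  proof -
    have "ennreal (R powr (x - 1) * exp (- R)) =
      ennreal (R powr (x - 1) * exp (- R)) * (\<integral>\<^sup>+ s. ennreal (exp (- (1 * s)) * RL_kernel 1 s) \<partial>lborel)"
      by (subst nn_integral_RL_kernel_exp) auto
    also have "\<dots> = (\<integral>\<^sup>+ s. ennreal (R powr (x - 1) * exp (- R)) * ennreal (exp (- (1 * s)) * RL_kernel 1 s) \<partial>lborel)"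
      by (intro nn_integral_cmult[symmetric]) auto
    also have "\<dots> \<le> (\<integral>\<^sup>+ s. ennreal (indicator {0..} (R + 1 * s) * (R + 1 * s) powr (x - 1) / exp (R + 1 * s)) \<partial>lborel)"
    proof (intro nn_integral_mono)
      fix s
      have "R powr (x - 1) * exp (- R) * (exp (- (1 * s)) * RL_kernel 1 s)
          \<le> indicator {0..} (R + 1 * s) * (R + 1 * s) powr (x - 1) / exp (R + 1 * s)"
      proof (cases "0 < s")
        case True
        have "R powr (x - 1) * exp (- (R + s)) \<le> (R + s) powr (x - 1) * exp (- (R + s))"
          using True R x by (intro mult_right_mono powr_mono2) auto
        moreover have "R powr (x - 1) * exp (- R) * (exp (- (1 * s)) * RL_kernel 1 s) = R powr (x - 1) * exp (- (R + s))"
          using True by (simp add: RL_kernel_one mult.assoc exp_add[symmetric])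
        moreover have "indicator {0..} (R + 1 * s) * (R + 1 * s) powr (x - 1) / exp (R + 1 * s) = (R + s) powr (x - 1) * exp (- (R + s))"
          using True R by (simp only: exp_minus divide_inverse) simp
        ultimately show ?thesis by (simp only:)
      next
        case False
        then show ?thesis by (simp add: indicator_def)
      qed
      then show "ennreal (R powr (x - 1) * exp (- R)) * ennreal (exp (- (1 * s)) * RL_kernel 1 s)
          \<le> ennreal (indicator {0..} (R + 1 * s) * (R + 1 * s) powr (x - 1) / exp (R + 1 * s))"
        by (subst ennreal_mult[symmetric]) (auto intro!: ennreal_leI)
    qed
    also have "\<dots> = ennreal \<bar>1\<bar> * (\<integral>\<^sup>+ s. ennreal (indicator {0..} (R + 1 * s) * (R + 1 * s) powr (x - 1) / exp (R + 1 * s)) \<partial>lborel)"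
      by simp
    also have "\<dots> = (\<integral>\<^sup>+ t. ennreal (indicator {0..} t * t powr (x - 1) / exp t) \<partial>lborel)"
      by (intro nn_integral_real_affine[symmetric]) auto
    also have "\<dots> = ennreal (Gamma x)"
      using Gamma_conv_nn_integral_real[of x] x by simp
    finally show ?thesis
      using x Gamma_real_nonneg[of x] by (subst (asm) ennreal_le_iff) auto
  qed
  show ?thesis
  proof (cases "1 \<le> x")
    case False
    \<comment> \<open>For x < 1 the bound at x + 1 is used: R \<ge> 1 permits raising the exponent,
      and Gamma (x + 1) = x * Gamma x \<le> Gamma x.\<close>
    have "R powr (x - 1) * exp (- R) \<le> R powr ((x + 1) - 1) * exp (- R)"
      using R by (intro mult_right_mono powr_mono) auto
    also have "\<dots> \<le> Gamma (x + 1)" using x by (intro ge1) auto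
    also have "\<dots> = x * Gamma x"
      using x by (intro Gamma_plus1) (auto dest: nonpos_Ints_nonpos)
    also have "\<dots> \<le> Gamma x"
      using False x by (intro mult_left_le_one_le) (auto simp: Gamma_real_nonneg)
    finally show ?thesis .
  qed (rule ge1)
qed

section \<open>Kernel bounds, stability and solvability\<close>

context horizon
begin

text \<open>For t > 0 the quotient of the two kernels is t^(k \<alpha>) * Gamma \<alpha> / Gamma ((k
  + 1) \<alpha>), which decays faster than any geometric sequence in k, uniformly on (0,T]. The
  ratio \<rho> is prescribed so that a caller can beat the norm of L.\<close>

lemma RL_kernel_mult_Suc_le:
  assumes \<alpha>: "0 < \<alpha>" and \<rho>: "0 < \<rho>"
  obtains C where "0 \<le> C" "\<And>k t. t \<le> T \<Longrightarrow> RL_kernel (real (Suc k) * \<alpha>) t \<le> C * \<rho> ^ k * RL_kernel \<alpha> t"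
proof
  \<comment> \<open>Chosen so that (T / R)^\<alpha> \<le> \<rho>. The bound
    \<open>Gamma_real_lower_bound\<close> at (k + 1) \<alpha> then leaves the factor (T / R)^(k
    \<alpha>), and \<open>C\<close> collects what does not depend on k.\<close>
  define R where "R = max 1 (T * \<rho> powr (- 1 / \<alpha>))"
  define C where "C = Gamma \<alpha> * exp R * R powr (1 - \<alpha>)"
  have R: "1 \<le> R" "T * \<rho> powr (- 1 / \<alpha>) \<le> R" by (auto simp: R_def)
  have G: "0 < Gamma \<alpha>" using \<alpha> by (simp add: Gamma_real_pos)
  show "0 \<le> C" using G by (simp add: C_def less_imp_le)
  have TR: "(T / R) powr \<alpha> \<le> \<rho>"
  proof -
    have "T \<le> R * \<rho> powr (1 / \<alpha>)"
      using mult_right_mono[OF R(2), of "\<rho> powr (1 / \<alpha>)"] \<rho> by (simp add: mult.assoc powr_add[symmetric])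
    then have "T / R \<le> \<rho> powr (1 / \<alpha>)"
      using R(1) by (simp add: field_simps)
    then have "(T / R) powr \<alpha> \<le> (\<rho> powr (1 / \<alpha>)) powr \<alpha>"
      using T_pos R(1) \<alpha> by (intro powr_mono2) auto
    then show ?thesis using \<alpha> \<rho> by (simp add: powr_powr)
  qed
  fix k :: nat and t :: real assume t: "t \<le> T"
  show "RL_kernel (real (Suc k) * \<alpha>) t \<le> C * \<rho> ^ k * RL_kernel \<alpha> t"
  proof (cases "0 < t")
    case True
    let ?g = "real (Suc k) * \<alpha>"
    have Gk: "R powr (?g - 1) * exp (- R) \<le> Gamma ?g"
      using \<alpha> R by (intro Gamma_real_lower_bound) auto
    have pos: "0 < R powr (?g - 1) * exp (- R)" using R by simp
    have "t powr (?g - 1) = t powr (\<alpha> - 1) * t powr (real k * \<alpha>)"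
      by (simp add: powr_add[symmetric] algebra_simps)
    also have "\<dots> \<le> t powr (\<alpha> - 1) * T powr (real k * \<alpha>)"
      using True t \<alpha> by (intro mult_left_mono powr_mono2) auto
    finally have "RL_kernel ?g t \<le> t powr (\<alpha> - 1) * T powr (real k * \<alpha>) / (R powr (?g - 1) * exp (- R))"
      using True Gk pos by (auto simp: RL_kernel_def intro!: frac_le)
    also have "R powr (?g - 1) = R powr (real k * \<alpha>) * R powr (\<alpha> - 1)"
      by (simp add: powr_add[symmetric] algebra_simps)
    also have "t powr (\<alpha> - 1) * T powr (real k * \<alpha>) / (R powr (real k * \<alpha>) * R powr (\<alpha> - 1) * exp (- R))
        = C * (T / R) powr (real k * \<alpha>) * RL_kernel \<alpha> t"
      using True R G T_pos
      by (simp add: C_def RL_kernel_def powr_divide exp_minus powr_diff field_simps)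
    also have "(T / R) powr (real k * \<alpha>) = ((T / R) powr \<alpha>) ^ k"
      using T_pos R by (simp add: powr_powr[symmetric] powr_realpow[symmetric] mult.commute)
    also have "C * ((T / R) powr \<alpha>) ^ k * RL_kernel \<alpha> t \<le> C * \<rho> ^ k * RL_kernel \<alpha> t"
      using TR \<open>0 \<le> C\<close> \<alpha> by (intro mult_right_mono mult_left_mono power_mono) auto
    finally show ?thesis .
  qed simp
qed

text \<open>Domination by a kernel survives fractional integration: the constant stays, the orders
  add. This drives the induction over the Picard increments.\<close>

lemma kernel_nn_bound:
  fixes f :: "real \<Rightarrow> 'a::euclidean_space"
  assumes b: "0 < \<beta>" and g: "0 < \<gamma>" and t: "t \<in> {0..T}" and A: "0 \<le> A"
    and f: "AE \<tau> in M. norm (f \<tau>) \<le> A * RL_kernel \<gamma> \<tau>"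
  shows "(\<integral>\<^sup>+ \<tau>. ennreal (RL_kernel \<beta> (t - \<tau>)) * ennreal (norm (f \<tau>)) \<partial>M) \<le> ennreal (A * RL_kernel (\<beta> + \<gamma>) t)"
proof -
  have "(\<integral>\<^sup>+ \<tau>. ennreal (RL_kernel \<beta> (t - \<tau>)) * ennreal (norm (f \<tau>)) \<partial>M)
      \<le> (\<integral>\<^sup>+ \<tau>. ennreal A * ennreal (RL_kernel \<beta> (t - \<tau>) * RL_kernel \<gamma> (\<tau> - 0)) \<partial>M)"
  proof (rule nn_integral_mono_AE)
    show "AE \<tau> in M. ennreal (RL_kernel \<beta> (t - \<tau>)) * ennreal (norm (f \<tau>)) \<le> ennreal A * ennreal (RL_kernel \<beta> (t - \<tau>) * RL_kernel \<gamma> (\<tau> - 0))"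
      using f
    proof eventually_elim
      case (elim \<tau>)
      have "RL_kernel \<beta> (t - \<tau>) * norm (f \<tau>) \<le> RL_kernel \<beta> (t - \<tau>) * (A * RL_kernel \<gamma> \<tau>)"
        using elim b by (intro mult_left_mono) auto
      then show ?case
        using b g A by (subst (1 2) ennreal_mult[symmetric]) (auto intro!: ennreal_leI simp: mult_ac)
    qed
  qed
  also have "\<dots> = ennreal A * (\<integral>\<^sup>+ \<tau>. ennreal (RL_kernel \<beta> (t - \<tau>) * RL_kernel \<gamma> (\<tau> - 0)) \<partial>M)"
    by (intro nn_integral_cmult) measurable
  also have "\<dots> = ennreal (A * RL_kernel (\<beta> + \<gamma>) t)"
    using t A b g by (subst kernel_conv) (auto simp: ennreal_mult)
  finally show ?thesis .
qed

lemma norm_RL_integral_kernel_le: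
  fixes f :: "real \<Rightarrow> 'a::euclidean_space"
  assumes "0 < \<beta>" "0 < \<gamma>" "t \<in> {0..T}" "0 \<le> A"
    and "AE \<tau> in M. norm (f \<tau>) \<le> A * RL_kernel \<gamma> \<tau>"
  shows "norm (RL_integral \<beta> f t) \<le> A * RL_kernel (\<beta> + \<gamma>) t"
  using order_trans[OF norm_RL_integral_le kernel_nn_bound[OF assms]] assms
  by (auto simp: ennreal_le_iff)

lemma kernel_bound_integrable:
  fixes f :: "real \<Rightarrow> 'a::euclidean_space"
  assumes "0 < \<beta>" "0 < \<gamma>" "t \<in> {0..T}" "0 \<le> A"
    and "AE \<tau> in M. norm (f \<tau>) \<le> A * RL_kernel \<gamma> \<tau>" and "f \<in> borel_measurable M"
  shows "integrable M (\<lambda>\<tau>. RL_kernel \<beta> (t - \<tau>) *\<^sub>R f \<tau>)"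
  using assms(1,6) le_less_trans[OF kernel_nn_bound[OF assms(1-5)]]
  by (intro kernel_integrableI) auto

text \<open>From 1 \<le> (T / t)^(1 - \<alpha>). It lets the bounded control be dominated by the
  same kernel as the state.\<close>

lemma bounded_le_kernel:
  assumes \<alpha>: "0 < \<alpha>" "\<alpha> \<le> 1" and R: "0 \<le> R" and t: "0 < t" "t \<le> T"
  shows "R \<le> R * (Gamma \<alpha> * T powr (1 - \<alpha>)) * RL_kernel \<alpha> t"
proof -
  have G: "0 < Gamma \<alpha>" using \<alpha> by (simp add: Gamma_real_pos)
  have "1 \<le> (T / t) powr (1 - \<alpha>)"
    using \<alpha> t by (intro ge_one_powr_ge_zero) auto
  also have "\<dots> = (Gamma \<alpha> * T powr (1 - \<alpha>)) * RL_kernel \<alpha> t"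
    using t T_pos G by (simp add: RL_kernel_def powr_divide powr_diff field_simps)
  finally show ?thesis using mult_left_mono[of 1 _ R] R by (simp add: mult.assoc)
qed

lemma kernel_bounded_Lp:
  fixes f :: "real \<Rightarrow> 'a::euclidean_space"
  assumes \<alpha>: "0 < \<alpha>" "\<alpha> < 1" and p: "0 < p" "p < 1 / (1 - \<alpha>)" and [measurable]: "f \<in> borel_measurable M"
    and A: "0 \<le> A" and f: "AE t in M. norm (f t) \<le> A * RL_kernel \<alpha> t"
  shows "f \<in> Lp_space p T"
proof -
  \<comment> \<open>The p-th power of the kernel of order \<alpha> is a multiple of the kernel of
    order \<gamma>, and \<gamma> > 0 is exactly the condition p < 1 / (1 - \<alpha>).\<close>
  define \<gamma> where "\<gamma> = (\<alpha> - 1) * p + 1"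
  have \<gamma>: "0 < \<gamma>" using \<alpha> p by (simp add: \<gamma>_def field_simps)
  have G: "0 < Gamma \<alpha>" "0 < Gamma \<gamma>" using \<alpha> \<gamma> by (auto simp: Gamma_real_pos)
  have "integrable M (\<lambda>t. RL_kernel \<gamma> t *\<^sub>R (A powr p * Gamma \<gamma> / Gamma \<alpha> powr p))"
    using \<gamma> by (rule RL_kernel_integrable)
  then have "integrable M (\<lambda>t. norm (f t) powr p)"
  proof (rule Bochner_Integration.integrable_bound)
    show "AE t in M. norm (norm (f t) powr p) \<le> norm (RL_kernel \<gamma> t *\<^sub>R (A powr p * Gamma \<gamma> / Gamma \<alpha> powr p))"
      using f AE_M_pos
    proof eventually_elim
      case (elim t)
      have "norm (f t) powr p \<le> (A * RL_kernel \<alpha> t) powr p"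
        using elim p by (intro powr_mono2) auto
      also have "\<dots> = RL_kernel \<gamma> t * (A powr p * Gamma \<gamma> / Gamma \<alpha> powr p)"
        using elim A G by (simp add: RL_kernel_def powr_mult powr_divide powr_powr \<gamma>_def)
      finally show ?case using \<gamma> G by (simp add: abs_mult)
    qed
  qed measurable
  then show ?thesis by (simp add: Lp_space_def)
qed

text \<open>Weighting by \<open>exp (- l t)\<close> turns \<open>I\<^sup>\<alpha>\<close> into an operator of norm at most \<open>l powr - \<alpha>\<close> on \<open>L\<^sup>1\<close>,
  a contraction against \<open>L\<close> once \<open>l\<close> is large.\<close>

lemma Volterra_stability:
  fixes L :: "'a::euclidean_space \<Rightarrow> 'a"
  assumes \<alpha>: "0 < \<alpha>" and L: "bounded_linear L"
  obtains C where "0 \<le> C"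
    "\<And>z w. integrable M z \<Longrightarrow> integrable M w \<Longrightarrow> (AE t in M. z t = RL_integral \<alpha> (\<lambda>\<tau>. L (z \<tau>) + w \<tau>) t) \<Longrightarrow>
      (\<integral>\<^sup>+ t. ennreal (norm (z t)) \<partial>M) \<le> ennreal C * (\<integral>\<^sup>+ t. ennreal (norm (w t)) \<partial>M)"
proof -
  obtain k where k: "0 < k" "\<And>v. norm (L v) \<le> norm v * k"
    using bounded_linear.pos_bounded[OF L] by blast
  \<comment> \<open>With this weight the norm of I^\<alpha> times the bound \<open>k\<close> of L is
    1/2.\<close>
  define l where "l = (2 * k) powr (1 / \<alpha>)"
  have l: "0 < l" using k by (simp add: l_def)
  have "l powr \<alpha> = 2 * k"
    using k(1) \<alpha> by (simp add: l_def powr_powr)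
  then have lk: "l powr - \<alpha> = 1 / (2 * k)"
    by (simp only: powr_minus inverse_eq_divide)
  show ?thesis
  \<comment> \<open>In the weighted norms X \<le> X / 2 + W / (2 k), hence X \<le> W / k; the factor
    \<open>exp (l * T)\<close> pays for removing the weight.\<close>
  proof (rule that[of "exp (l * T) / k"])
    fix z w :: "real \<Rightarrow> 'a"
    assume z: "integrable M z" and w: "integrable M w"
      and ae: "AE t in M. z t = RL_integral \<alpha> (\<lambda>\<tau>. L (z \<tau>) + w \<tau>) t"
    have [measurable]: "z \<in> borel_measurable M" "w \<in> borel_measurable M" using z w by auto
    have Lz: "integrable M (\<lambda>t. L (z t))" by (rule integrable_bounded_linear[OF L z])
    then have [measurable]: "(\<lambda>t. L (z t)) \<in> borel_measurable M" by auto
    define X where "X = (\<integral>\<^sup>+ t. ennreal (exp (- (l * t))) * ennreal (norm (z t)) \<partial>M)"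
    define W where "W = (\<integral>\<^sup>+ t. ennreal (exp (- (l * t))) * ennreal (norm (w t)) \<partial>M)"
    have "X \<le> (\<integral>\<^sup>+ t. ennreal (norm (z t)) \<partial>M)"
      unfolding X_def using l by (intro exp_weight_upper) auto
    also have "\<dots> < \<infinity>" using z by (auto simp: integrable_iff_bounded)
    finally have Xf: "X < \<infinity>" .
    have "W \<le> (\<integral>\<^sup>+ t. ennreal (norm (w t)) \<partial>M)"
      unfolding W_def using l by (intro exp_weight_upper) auto
    note W_le = this
    also have "\<dots> < \<infinity>" using w by (auto simp: integrable_iff_bounded)
    finally have Wf: "W < \<infinity>" .
    have "X = (\<integral>\<^sup>+ t. ennreal (exp (- (l * t))) * ennreal (norm (RL_integral \<alpha> (\<lambda>\<tau>. L (z \<tau>) + w \<tau>) t)) \<partial>M)"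
      unfolding X_def by (rule nn_integral_cong_AE) (use ae in eventually_elim, simp)
    also have "\<dots> \<le> ennreal (l powr - \<alpha>) * (\<integral>\<^sup>+ t. ennreal (exp (- (l * t))) * ennreal (norm (L (z t) + w t)) \<partial>M)"
      using \<alpha> l by (intro RL_integral_weighted_le) auto
    also have "(\<integral>\<^sup>+ t. ennreal (exp (- (l * t))) * ennreal (norm (L (z t) + w t)) \<partial>M)
        \<le> (\<integral>\<^sup>+ t. ennreal k * (ennreal (exp (- (l * t))) * ennreal (norm (z t))) + ennreal (exp (- (l * t))) * ennreal (norm (w t)) \<partial>M)"
    proof (intro nn_integral_mono)
      fix t
      have "norm (L (z t) + w t) \<le> k * norm (z t) + norm (w t)"
        using norm_triangle_ineq[of "L (z t)" "w t"] k(2)[of "z t"] by (simp add: mult.commute)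
      then have "exp (- (l * t)) * norm (L (z t) + w t) \<le> exp (- (l * t)) * (k * norm (z t) + norm (w t))"
        by (intro mult_left_mono) auto
      then show "ennreal (exp (- (l * t))) * ennreal (norm (L (z t) + w t))
        \<le> ennreal k * (ennreal (exp (- (l * t))) * ennreal (norm (z t))) + ennreal (exp (- (l * t))) * ennreal (norm (w t))"
        using k(1) by (simp add: ennreal_mult[symmetric] ennreal_plus[symmetric] ennreal_leI algebra_simps del: ennreal_plus)
    qed
    also have "\<dots> = ennreal k * X + W"
      unfolding X_def W_def by (subst nn_integral_add) (auto simp: nn_integral_cmult)
    finally have main: "X \<le> ennreal (l powr - \<alpha>) * (ennreal k * X + W)"
      by (auto simp: mult_left_mono)
    \<comment> \<open>Absorbing half of \<open>X\<close> into the left-hand side requires finite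
      \<open>X\<close>; this is where integrability of \<open>z\<close> is used.\<close>
    obtain rx rw where r: "X = ennreal rx" "W = ennreal rw" "0 \<le> rx" "0 \<le> rw"
      using Xf Wf by (metis ennreal_cases less_irrefl infinity_ennreal_def)
    have "rx \<le> 1 / (2 * k) * (k * rx + rw)"
      using main k(1) r unfolding lk by (simp add: ennreal_mult[symmetric] ennreal_plus[symmetric] del: ennreal_plus)
    then have "rx \<le> rw / k"
      using k(1) by (simp add: field_simps)
    then have XW: "X \<le> ennreal (1 / k) * W"
      using r k by (simp add: ennreal_mult[symmetric] ennreal_leI)
    have "(\<integral>\<^sup>+ t. ennreal (norm (z t)) \<partial>M) \<le> ennreal (exp (l * T)) * X"
      unfolding X_def using l by (intro exp_weight_lower) auto
    also have "\<dots> \<le> ennreal (exp (l * T)) * (ennreal (1 / k) * (\<integral>\<^sup>+ t. ennreal (norm (w t)) \<partial>M))"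
      by (intro mult_left_mono order_trans[OF XW] W_le) auto
    also have "\<dots> = ennreal (exp (l * T) / k) * (\<integral>\<^sup>+ t. ennreal (norm (w t)) \<partial>M)"
      using k(1) by (simp add: ennreal_mult[symmetric] mult.assoc[symmetric])
    finally show "(\<integral>\<^sup>+ t. ennreal (norm (z t)) \<partial>M) \<le> ennreal (exp (l * T) / k) * (\<integral>\<^sup>+ t. ennreal (norm (w t)) \<partial>M)" .
  qed (use k in auto)
qed

text \<open>The Picard increments obey \<open>d n\<close> = O(k^n times the kernel of order (n + 1)
  \<alpha>), so their series converges pointwise and its sum is again dominated by the kernel of
  order \<alpha>. That pointwise bound is what \<open>kernel_bounded_Lp\<close> consumes.\<close>

lemma Volterra_exists:
  fixes L :: "'a::euclidean_space \<Rightarrow> 'a"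
  assumes \<alpha>: "0 < \<alpha>" "\<alpha> \<le> 1" and L: "bounded_linear L"
    and f [measurable]: "f \<in> borel_measurable M" and R: "0 \<le> R" "\<And>t. t \<in> {0..T} \<Longrightarrow> norm (f t) \<le> R"
  obtains x A where "x \<in> borel_measurable M" "0 \<le> A"
    "\<And>t. t \<in> {0..T} \<Longrightarrow> norm (x t) \<le> A * RL_kernel \<alpha> t"
    "\<And>t. t \<in> {0..T} \<Longrightarrow> x t = RL_integral \<alpha> (\<lambda>\<tau>. L (x \<tau>) + f \<tau>) t + RL_kernel \<alpha> t *\<^sub>R b"
proof -
  obtain k where k: "0 < k" "\<And>v. norm (L v) \<le> norm v * k"
    using bounded_linear.pos_bounded[OF L] by blast
  have Lm: "L \<in> borel_measurable borel"
    using L by (intro borel_measurable_continuous_onI linear_continuous_on)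
  \<comment> \<open>Each application of L costs a factor \<open>k\<close>; the ratio
    \<open>1 / (2 * k)\<close> turns k^n into (1/2)^n.\<close>
  obtain C where C: "0 \<le> C" "\<And>n t. t \<le> T \<Longrightarrow> RL_kernel (real (Suc n) * \<alpha>) t \<le> C * (1 / (2 * k)) ^ n * RL_kernel \<alpha> t"
    using RL_kernel_mult_Suc_le[OF \<alpha>(1), of "1 / (2 * k)"] k(1) by auto
  define R1 where "R1 = R * (Gamma \<alpha> * T powr (1 - \<alpha>))"
  have R1: "0 \<le> R1" using R \<alpha> by (simp add: R1_def Gamma_real_nonneg)
  have f_le: "AE t in M. norm (f t) \<le> R1 * RL_kernel \<alpha> t"
    using AE_M_pos AE_space
  proof eventually_elim
    case (elim t)
    then show ?case
      using bounded_le_kernel[OF \<alpha> R(1), of t] R(2)[of t] by (auto simp: R1_def)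
  qed
  have mk [measurable]: "RL_kernel \<alpha> \<in> borel_measurable M" by measurable
  define d0 where "d0 = (\<lambda>t. RL_integral \<alpha> f t + RL_kernel \<alpha> t *\<^sub>R b)"
  have d0m: "d0 \<in> borel_measurable M"
    unfolding d0_def by (intro borel_measurable_add RL_integral_measurable borel_measurable_scaleR) auto
  \<comment> \<open>The term I^\<alpha> f is dominated by the kernel of order 2 \<alpha>, the case n
    = 1 of the bound \<open>C\<close>; the singular term contributes \<open>norm b\<close>.\<close>
  define C0 where "C0 = R1 * (C * (1 / (2 * k))) + norm b"
  have C0: "0 \<le> C0" using R1 C k by (simp add: C0_def)
  have d0_le: "norm (d0 t) \<le> C0 * RL_kernel \<alpha> t" if t: "t \<in> {0..T}" for t
  proof -
    have "norm (RL_integral \<alpha> f t) \<le> R1 * RL_kernel (\<alpha> + \<alpha>) t"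
      using \<alpha> t R1 f_le by (intro norm_RL_integral_kernel_le) auto
    also have "\<alpha> + \<alpha> = real (Suc 1) * \<alpha>" by simp
    also have "R1 * RL_kernel (real (Suc 1) * \<alpha>) t \<le> R1 * (C * (1 / (2 * k)) ^ 1 * RL_kernel \<alpha> t)"
      using t R1 by (intro mult_left_mono C) auto
    finally have "norm (RL_integral \<alpha> f t) \<le> R1 * (C * (1 / (2 * k)) * RL_kernel \<alpha> t)" by simp
    moreover have "norm (RL_kernel \<alpha> t *\<^sub>R b) = norm b * RL_kernel \<alpha> t" using \<alpha> by simp
    ultimately show ?thesis
      using norm_triangle_ineq[of "RL_integral \<alpha> f t" "RL_kernel \<alpha> t *\<^sub>R b"]
      unfolding d0_def C0_def by (simp only: distrib_right mult.assoc)
  qed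
  define d where "d = rec_nat d0 (\<lambda>_ e. RL_integral \<alpha> (\<lambda>\<tau>. L (e \<tau>)))"
  have d_0: "d 0 = d0" and d_Suc: "d (Suc n) = RL_integral \<alpha> (\<lambda>\<tau>. L (d n \<tau>))" for n
    by (auto simp: d_def)
  have dm [measurable]: "d n \<in> borel_measurable M" for n
    by (induction n) (auto simp: d_0 d_Suc d0m intro!: RL_integral_measurable measurable_compose[OF _ Lm])
  have d_le': "norm (d n t) \<le> C0 * k ^ n * RL_kernel (real (Suc n) * \<alpha>) t" if "t \<in> {0..T}" for n t
    using that
  proof (induction n arbitrary: t)
    case 0
    then show ?case using d0_le by (simp add: d_0)
  next
    case (Suc n)
    have "AE \<tau> in M. norm (L (d n \<tau>)) \<le> (C0 * k ^ Suc n) * RL_kernel (real (Suc n) * \<alpha>) \<tau>"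
    proof (rule AE_I2)
      fix \<tau> assume "\<tau> \<in> space M"
      then have "norm (d n \<tau>) * k \<le> C0 * k ^ n * RL_kernel (real (Suc n) * \<alpha>) \<tau> * k"
        using k(1) Suc.IH[of \<tau>] by (intro mult_right_mono) auto
      then show "norm (L (d n \<tau>)) \<le> (C0 * k ^ Suc n) * RL_kernel (real (Suc n) * \<alpha>) \<tau>"
        using k(2)[of "d n \<tau>"] by (simp add: mult_ac)
    qed
    then have "norm (d (Suc n) t) \<le> (C0 * k ^ Suc n) * RL_kernel (\<alpha> + real (Suc n) * \<alpha>) t"
      unfolding d_Suc using \<alpha> Suc.prems C0 k by (intro norm_RL_integral_kernel_le) auto
    also have "\<alpha> + real (Suc n) * \<alpha> = real (Suc (Suc n)) * \<alpha>" by (simp add: algebra_simps)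
    finally show ?case .
  qed
  define B where "B = C0 * C"
  have B: "0 \<le> B" using C0 C by (simp add: B_def)
  have d_le: "norm (d n t) \<le> B * RL_kernel \<alpha> t * (1 / 2) ^ n" if t: "t \<in> {0..T}" for n t
  proof -
    have "norm (d n t) \<le> C0 * k ^ n * RL_kernel (real (Suc n) * \<alpha>) t" by (rule d_le'[OF t])
    also have "\<dots> \<le> C0 * k ^ n * (C * (1 / (2 * k)) ^ n * RL_kernel \<alpha> t)"
      using t C0 k by (intro mult_left_mono C) auto
    also have "\<dots> = B * RL_kernel \<alpha> t * (1 / 2) ^ n"
      using k(1) by (simp add: B_def power_divide power_mult_distrib)
    finally show ?thesis .
  qed
  define s where "s = (\<lambda>n t. \<Sum>i<n. d i t)"
  define x where "x = (\<lambda>t. \<Sum>i. d i t)"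
  have geo: "summable (\<lambda>n. B * RL_kernel \<alpha> t * (1 / 2) ^ n)" for t
    by (intro summable_mult summable_geometric) auto
  have s_lim: "(\<lambda>n. s n t) \<longlonglongrightarrow> x t" if t: "t \<in> {0..T}" for t
    unfolding s_def x_def by (intro summable_LIMSEQ summable_comparison_test'[OF geo, of 0]) (use d_le[OF t] in auto)
  have s_le: "norm (s n t) \<le> 2 * B * RL_kernel \<alpha> t" if t: "t \<in> {0..T}" for n t
  proof -
    have "norm (s n t) \<le> (\<Sum>i<n. B * RL_kernel \<alpha> t * (1 / 2) ^ i)"
      unfolding s_def by (rule sum_norm_le) (rule d_le[OF t])
    also have "\<dots> \<le> (\<Sum>i. B * RL_kernel \<alpha> t * (1 / 2) ^ i)"
      using B \<alpha> by (intro sum_le_suminf geo) auto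
    also have "\<dots> = 2 * B * RL_kernel \<alpha> t"
      by (subst suminf_mult) (auto simp: suminf_geometric)
    finally show ?thesis .
  qed
  have x_le: "norm (x t) \<le> 2 * B * RL_kernel \<alpha> t" if t: "t \<in> {0..T}" for t
    by (rule LIMSEQ_le_const2[OF tendsto_norm[OF s_lim[OF t]]]) (use s_le[OF t] in auto)
  have sm: "s n \<in> borel_measurable M" for n
    unfolding s_def by measurable
  have xm: "x \<in> borel_measurable M"
    by (rule borel_measurable_LIMSEQ_metric[where f = s]) (use sm s_lim in auto)
  have L_le: "AE \<tau> in M. norm (L (y \<tau>)) \<le> k * E * RL_kernel \<alpha> \<tau>"
    if "\<And>t. t \<in> {0..T} \<Longrightarrow> norm (y t) \<le> E * RL_kernel \<alpha> t" for y E
  proof (rule AE_I2)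
    fix \<tau> assume "\<tau> \<in> space M"
    then have "norm (y \<tau>) * k \<le> E * RL_kernel \<alpha> \<tau> * k"
      using k(1) that[of \<tau>] by (intro mult_right_mono) auto
    then show "norm (L (y \<tau>)) \<le> k * E * RL_kernel \<alpha> \<tau>"
      using k(2)[of "y \<tau>"] by (simp add: mult_ac)
  qed
  have eq: "x t = RL_integral \<alpha> (\<lambda>\<tau>. L (x \<tau>) + f \<tau>) t + RL_kernel \<alpha> t *\<^sub>R b" if t: "t \<in> {0..T}" for t
  proof -
    have Ld: "AE \<tau> in M. norm (L (d n \<tau>)) \<le> k * (B * (1/2)^n) * RL_kernel \<alpha> \<tau>" for n
      by (rule L_le) (use d_le in \<open>simp add: mult_ac\<close>)
    have d_int: "integrable M (\<lambda>\<tau>. RL_kernel \<alpha> (t - \<tau>) *\<^sub>R L (d n \<tau>))" for n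
      by (rule kernel_bound_integrable[where \<gamma> = \<alpha> and A = "k * (B * (1/2)^n)"])
         (use \<alpha> t B k in \<open>auto intro!: Ld measurable_compose[OF _ Lm]\<close>)
    \<comment> \<open>The partial sums are the Picard iterates, so passing to the limit on both
      sides yields the fixed-point equation.\<close>
    have s_Suc: "s (Suc n) t = d0 t + RL_integral \<alpha> (\<lambda>\<tau>. L (s n \<tau>)) t" for n
    proof -
      have "RL_integral \<alpha> (\<lambda>\<tau>. L (s n \<tau>)) t = (\<integral>\<tau>. (\<Sum>i<n. RL_kernel \<alpha> (t - \<tau>) *\<^sub>R L (d i \<tau>)) \<partial>M)"
        unfolding RL_integral_eq[OF t] s_def
        by (simp add: linear_sum[OF bounded_linear.linear[OF L]] scaleR_sum_right)
      also have "\<dots> = (\<Sum>i<n. d (Suc i) t)"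
        using d_int by (subst Bochner_Integration.integral_sum) (auto simp: d_Suc RL_integral_eq[OF t])
      finally show ?thesis by (simp only: s_def sum.lessThan_Suc_shift d_0)
    qed
    have Ls: "AE \<tau> in M. norm (L (s n \<tau>)) \<le> k * (2 * B) * RL_kernel \<alpha> \<tau>" for n
      by (rule L_le) (rule s_le)
    \<comment> \<open>The majorant for dominated convergence. It is integrable for every t in [0,T],
      since the convolution of two kernels is a kernel, finite everywhere.\<close>
    have wint: "integrable M (\<lambda>\<tau>. RL_kernel \<alpha> (t - \<tau>) *\<^sub>R (k * (2 * B) * RL_kernel \<alpha> \<tau>))"
      by (rule kernel_bound_integrable[where \<gamma> = \<alpha> and A = "k * (2 * B)"]) (use \<alpha> t B k in auto)
    have "(\<lambda>n. RL_integral \<alpha> (\<lambda>\<tau>. L (s n \<tau>)) t) \<longlonglongrightarrow> RL_integral \<alpha> (\<lambda>\<tau>. L (x \<tau>)) t"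
      unfolding RL_integral_eq[OF t]
    proof (rule integral_dominated_convergence[where w = "\<lambda>\<tau>. RL_kernel \<alpha> (t - \<tau>) *\<^sub>R (k * (2 * B) * RL_kernel \<alpha> \<tau>)"])
      show "AE \<tau> in M. (\<lambda>n. RL_kernel \<alpha> (t - \<tau>) *\<^sub>R L (s n \<tau>)) \<longlonglongrightarrow> RL_kernel \<alpha> (t - \<tau>) *\<^sub>R L (x \<tau>)"
        by (intro AE_I2 tendsto_scaleR tendsto_const bounded_linear.tendsto[OF L] s_lim) auto
      show "AE \<tau> in M. norm (RL_kernel \<alpha> (t - \<tau>) *\<^sub>R L (s n \<tau>)) \<le> RL_kernel \<alpha> (t - \<tau>) *\<^sub>R (k * (2 * B) * RL_kernel \<alpha> \<tau>)" for n
        using Ls[of n] by eventually_elim (use \<alpha> in \<open>auto intro!: mult_left_mono\<close>)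
    qed (use wint xm sm in \<open>auto intro!: measurable_compose[OF _ Lm] borel_measurable_scaleR\<close>)
    then have "(\<lambda>n. s (Suc n) t) \<longlonglongrightarrow> d0 t + RL_integral \<alpha> (\<lambda>\<tau>. L (x \<tau>)) t"
      unfolding s_Suc by (intro tendsto_add tendsto_const)
    with LIMSEQ_Suc[OF s_lim[OF t]] have "x t = d0 t + RL_integral \<alpha> (\<lambda>\<tau>. L (x \<tau>)) t"
      by (rule LIMSEQ_unique)
    also have "\<dots> = RL_integral \<alpha> (\<lambda>\<tau>. L (x \<tau>)) t + RL_integral \<alpha> f t + RL_kernel \<alpha> t *\<^sub>R b"
      by (simp add: d0_def)
    also have "RL_integral \<alpha> (\<lambda>\<tau>. L (x \<tau>)) t + RL_integral \<alpha> f t = RL_integral \<alpha> (\<lambda>\<tau>. L (x \<tau>) + f \<tau>) t"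
    proof (rule RL_integral_add[symmetric, OF t])
      show "integrable M (\<lambda>\<tau>. RL_kernel \<alpha> (t - \<tau>) *\<^sub>R L (x \<tau>))"
        by (rule kernel_bound_integrable[where \<gamma> = \<alpha> and A = "k * (2 * B)"])
           (use \<alpha> t B k x_le xm in \<open>auto intro!: L_le measurable_compose[OF _ Lm]\<close>)
      show "integrable M (\<lambda>\<tau>. RL_kernel \<alpha> (t - \<tau>) *\<^sub>R f \<tau>)"
        by (rule kernel_bound_integrable[where \<gamma> = \<alpha> and A = R1]) (use \<alpha> t R1 f_le in auto)
    qed
    finally show ?thesis .
  qed
  show ?thesis
    using B by (intro that[OF xm _ x_le eq]) auto
qed

end

section \<open>The direct method\<close>

lemma norm_axis_le: "norm (axis k v :: 'a::real_normed_vector^'n::finite) \<le> norm v"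
proof -
  have "norm (axis k v :: 'a^'n) \<le> (\<Sum>i\<in>UNIV. norm ((axis k v :: 'a^'n) $ i))"
    unfolding norm_vec_def by (rule L2_set_le_sum) simp
  also have "\<dots> = (\<Sum>i\<in>UNIV. if i = k then norm v else 0)"
    by (intro sum.cong) (auto simp: axis_def)
  also have "\<dots> = norm v" by simp
  finally show ?thesis .
qed

section \<open>Convexity of the cost\<close>

definition HK_integrand :: "real \<Rightarrow> (real^'d)^('n::finite option) \<Rightarrow> real^'d \<Rightarrow> real" where
  "HK_integrand \<nu> x u = 1 / (2 * (real CARD('n))\<^sup>2)
           * (\<Sum>i\<in>UNIV. \<Sum>j\<in>UNIV. (norm (x $ Some i - x $ Some j))\<^sup>2)
         + 1 / 2 * (\<Sum>i\<in>UNIV. (norm (x $ None - x $ Some i))\<^sup>2)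
         + \<nu> / 2 * (norm u)\<^sup>2"

lemma HK_cost_eq: "HK_cost T \<nu> x u = (\<integral>\<^sup>+ t. ennreal (HK_integrand \<nu> (x t) (u t)) \<partial>lebesgue_on {0..T})"
  by (simp add: HK_cost_def HK_integrand_def)

lemma HK_integrand_nonneg: "0 \<le> \<nu> \<Longrightarrow> 0 \<le> HK_integrand \<nu> x u"
  by (auto simp: HK_integrand_def intro!: add_nonneg_nonneg mult_nonneg_nonneg divide_nonneg_nonneg sum_nonneg)

lemma continuous_HK_integrand: "continuous_on UNIV (\<lambda>z. HK_integrand \<nu> (fst z) (snd z))"
  unfolding HK_integrand_def by (intro continuous_intros)

text \<open>The parallelogram identity, rescaled to the midpoint.\<close>

lemma norm_midpoint_sq:
  fixes a b :: "'a::real_inner"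
  shows "2 * (norm ((1 / 2) *\<^sub>R (a + b)))\<^sup>2 + (norm (a - b))\<^sup>2 / 2 = (norm a)\<^sup>2 + (norm b)\<^sup>2"
  by (simp add: power2_norm_eq_inner inner_add_left inner_add_right inner_diff_left inner_diff_right inner_commute field_simps)

lemma norm_midpoint_sq_le:
  fixes a b :: "'a::real_inner"
  shows "2 * (norm ((1 / 2) *\<^sub>R (a + b)))\<^sup>2 \<le> (norm a)\<^sup>2 + (norm b)\<^sup>2"
  using norm_midpoint_sq[of a b] zero_le_power2[of "norm (a - b)"] by linarith

text \<open>The state terms see only differences of components, so their convexity surplus is
  dropped. The control term keeps its surplus: \<nu>/2 times one half of the squared
  distance.\<close>

lemma HK_integrand_midpoint:
  fixes x y :: "(real^'d)^('n::finite option)"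
  shows "2 * HK_integrand \<nu> ((1 / 2) *\<^sub>R (x + y)) ((1 / 2) *\<^sub>R (u + v)) + \<nu> / 4 * (norm (u - v))\<^sup>2
    \<le> HK_integrand \<nu> x u + HK_integrand \<nu> y v"
proof -
  let ?z = "(1 / 2) *\<^sub>R (x + y)"
  have diff: "?z $ k - ?z $ l = (1 / 2) *\<^sub>R ((x $ k - x $ l) + (y $ k - y $ l))" for k l
    by (simp add: vec_eq_iff field_simps)
  have le: "2 * (norm (?z $ k - ?z $ l))\<^sup>2 \<le> (norm (x $ k - x $ l))\<^sup>2 + (norm (y $ k - y $ l))\<^sup>2" for k l
    unfolding diff by (rule norm_midpoint_sq_le)
  define S1 where "S1 = (\<lambda>w :: (real^'d)^('n option). \<Sum>i\<in>UNIV. \<Sum>j\<in>UNIV. (norm (w $ Some i - w $ Some j))\<^sup>2)"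
  define S2 where "S2 = (\<lambda>w :: (real^'d)^('n option). \<Sum>i\<in>UNIV. (norm (w $ None - w $ Some i))\<^sup>2)"
  have 1: "2 * S1 ?z \<le> S1 x + S1 y"
    unfolding S1_def sum_distrib_left sum.distrib[symmetric] by (intro sum_mono le)
  have 2: "2 * S2 ?z \<le> S2 x + S2 y"
    unfolding S2_def sum_distrib_left sum.distrib[symmetric] by (intro sum_mono le)
  have 3: "2 * (\<nu> / 2 * (norm ((1 / 2) *\<^sub>R (u + v)))\<^sup>2) + \<nu> / 4 * (norm (u - v))\<^sup>2 = \<nu> / 2 * (norm u)\<^sup>2 + \<nu> / 2 * (norm v)\<^sup>2"
    using arg_cong[OF norm_midpoint_sq[of u v], of "\<lambda>r. \<nu> / 2 * r"] by (simp add: algebra_simps)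
  define c where "c = 1 / (2 * (real CARD('n))\<^sup>2)"
  have c: "0 \<le> c" by (simp add: c_def)
  have "2 * (c * S1 ?z) \<le> c * S1 x + c * S1 y"
    using mult_left_mono[OF 1 c] by (simp add: algebra_simps)
  moreover have I: "HK_integrand \<nu> w r = c * S1 w + 1 / 2 * S2 w + \<nu> / 2 * (norm r)\<^sup>2" for w r
    by (simp add: HK_integrand_def c_def S1_def S2_def)
  ultimately show ?thesis
    unfolding I using 2 3 by argo
qed

context horizon
begin

lemma HK_integrand_measurable:
  fixes x :: "real \<Rightarrow> (real^'d)^('n::finite option)"
  assumes "x \<in> borel_measurable M" "u \<in> borel_measurable M"
  shows "(\<lambda>t. HK_integrand \<nu> (x t) (u t)) \<in> borel_measurable M"
proof -
  have "(\<lambda>t. (x t, u t)) \<in> borel_measurable M"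
    using assms by (rule borel_measurable_Pair)
  from measurable_compose[OF this borel_measurable_continuous_onI[OF continuous_HK_integrand]]
  show ?thesis by simp
qed

text \<open>The surplus is added on the left instead of being subtracted on the right, since the
  costs may be infinite.\<close>

lemma HK_cost_midpoint:
  fixes x y :: "real \<Rightarrow> (real^'d)^('n::finite option)"
  assumes \<nu>: "0 \<le> \<nu>" and [measurable]: "x \<in> borel_measurable M" "u \<in> borel_measurable M" "y \<in> borel_measurable M" "v \<in> borel_measurable M"
  shows "2 * HK_cost T \<nu> (\<lambda>t. (1 / 2) *\<^sub>R (x t + y t)) (\<lambda>t. (1 / 2) *\<^sub>R (u t + v t))
      + ennreal (\<nu> / 4) * (\<integral>\<^sup>+ t. ennreal ((norm (u t - v t))\<^sup>2) \<partial>M) \<le> HK_cost T \<nu> x u + HK_cost T \<nu> y v"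
proof -
  let ?q = "\<lambda>t. HK_integrand \<nu> ((1 / 2) *\<^sub>R (x t + y t)) ((1 / 2) *\<^sub>R (u t + v t))"
  have [measurable]: "?q \<in> borel_measurable M" "(\<lambda>t. HK_integrand \<nu> (x t) (u t)) \<in> borel_measurable M"
    "(\<lambda>t. HK_integrand \<nu> (y t) (v t)) \<in> borel_measurable M"
    by (intro HK_integrand_measurable; measurable)+
  have "2 * (\<integral>\<^sup>+ t. ennreal (?q t) \<partial>M) + ennreal (\<nu> / 4) * (\<integral>\<^sup>+ t. ennreal ((norm (u t - v t))\<^sup>2) \<partial>M)
      = (\<integral>\<^sup>+ t. 2 * ennreal (?q t) + ennreal (\<nu> / 4) * ennreal ((norm (u t - v t))\<^sup>2) \<partial>M)"
    by (subst nn_integral_add) (auto simp: nn_integral_cmult)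
  also have "\<dots> \<le> (\<integral>\<^sup>+ t. ennreal (HK_integrand \<nu> (x t) (u t)) + ennreal (HK_integrand \<nu> (y t) (v t)) \<partial>M)"
  proof (intro nn_integral_mono)
    fix t
    have "2 * ennreal (?q t) + ennreal (\<nu> / 4) * ennreal ((norm (u t - v t))\<^sup>2)
      = ennreal (2 * ?q t + \<nu> / 4 * (norm (u t - v t))\<^sup>2)"
    proof -
      have q: "0 \<le> ?q t" by (rule HK_integrand_nonneg[OF \<nu>])
      have "ennreal (2 * ?q t + \<nu> / 4 * (norm (u t - v t))\<^sup>2) = ennreal (2 * ?q t) + ennreal (\<nu> / 4 * (norm (u t - v t))\<^sup>2)"
        using q \<nu> by (intro ennreal_plus) auto
      also have "ennreal (2 * ?q t) = ennreal 2 * ennreal (?q t)"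
        by (intro ennreal_mult q) simp
      also have "ennreal (\<nu> / 4 * (norm (u t - v t))\<^sup>2) = ennreal (\<nu> / 4) * ennreal ((norm (u t - v t))\<^sup>2)"
        using \<nu> by (intro ennreal_mult) auto
      finally show ?thesis by simp
    qed
    also have "\<dots> \<le> ennreal (HK_integrand \<nu> (x t) (u t) + HK_integrand \<nu> (y t) (v t))"
      by (intro ennreal_leI HK_integrand_midpoint)
    also have "\<dots> = ennreal (HK_integrand \<nu> (x t) (u t)) + ennreal (HK_integrand \<nu> (y t) (v t))"
      using HK_integrand_nonneg[OF \<nu>] by (intro ennreal_plus) auto
    finally show "2 * ennreal (?q t) + ennreal (\<nu> / 4) * ennreal ((norm (u t - v t))\<^sup>2)
      \<le> ennreal (HK_integrand \<nu> (x t) (u t)) + ennreal (HK_integrand \<nu> (y t) (v t))" .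
  qed
  also have "\<dots> = HK_cost T \<nu> x u + HK_cost T \<nu> y v"
    unfolding HK_cost_eq by (intro nn_integral_add) auto
  finally show ?thesis unfolding HK_cost_eq .
qed

section \<open>Admissible pairs: existence, midpoints, stability\<close>

lemma control_set_measurable:
  "u \<in> control_set K T \<Longrightarrow> u \<in> borel_measurable M"
  by (auto simp: control_set_def)

lemma control_setI:
  assumes u: "u \<in> borel_measurable M" and K: "\<And>t. t \<in> {0..T} \<Longrightarrow> norm (u t) \<le> K"
  shows "u \<in> control_set K T"
proof -
  have "integrable M u"
    by (rule M.integrable_const_bound[of _ K]) (use K u in auto)
  then show ?thesis using K by (simp add: control_set_def)
qed

lemma bounded_linear_HK_drift: "bounded_linear (HK_drift a c)"
  by (rule linear_conv_bounded_linear[THEN iffD1, OF linear_HK_drift])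

lemma measurable_axis:
  fixes u :: "real \<Rightarrow> 'b::euclidean_space"
  assumes "u \<in> borel_measurable M"
  shows "(\<lambda>t. axis k (u t) :: 'b^'n::finite) \<in> borel_measurable M"
  by (rule measurable_compose[OF assms borel_measurable_continuous_onI])
     (intro linear_continuous_on linear_conv_bounded_linear[THEN iffD1] linear_axis)

text \<open>The norm of a midpoint is at most the larger of the two norms, so its p-th power is at
  most the sum of the p-th powers.\<close>

lemma Lp_space_midpoint:
  fixes f g :: "real \<Rightarrow> 'a::euclidean_space"
  assumes p: "0 \<le> p" and f: "f \<in> Lp_space p T" and g: "g \<in> Lp_space p T"
  shows "(\<lambda>t. (1 / 2) *\<^sub>R (f t + g t)) \<in> Lp_space p T"
proof -
  have [measurable]: "f \<in> borel_measurable M" "g \<in> borel_measurable M"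
    using f g by (auto simp: Lp_space_def)
  have i: "integrable M (\<lambda>t. norm (f t) powr p + norm (g t) powr p)"
    using f g by (auto simp: Lp_space_def)
  have le: "norm ((1 / 2) *\<^sub>R (a + b)) powr p \<le> norm a powr p + norm b powr p" for a b :: 'a
  proof -
    have "norm ((1 / 2) *\<^sub>R (a + b)) \<le> max (norm a) (norm b)"
      using norm_triangle_ineq[of a b] by simp
    then have "norm ((1 / 2) *\<^sub>R (a + b)) powr p \<le> max (norm a) (norm b) powr p"
      using p by (intro powr_mono2) auto
    also have "\<dots> \<le> norm a powr p + norm b powr p" by (auto simp: max_def)
    finally show ?thesis .
  qed
  have "integrable M (\<lambda>t. norm ((1 / 2) *\<^sub>R (f t + g t)) powr p)"
  proof (rule Bochner_Integration.integrable_bound[OF i])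
    show "AE t in M. norm (norm ((1 / 2) *\<^sub>R (f t + g t)) powr p) \<le> norm (norm (f t) powr p + norm (g t) powr p)"
      using le by (intro AE_I2) (simp only: real_norm_def abs_of_nonneg powr_ge_zero add_nonneg_nonneg)
  qed measurable
  then show ?thesis by (simp add: Lp_space_def)
qed

text \<open>Every control has a state. Both the drift along the Volterra solution and the bounded
  control are dominated by a multiple of the kernel of order \<alpha>, and this places their sum in
  L^p.\<close>

lemma HK_admissible_exists:
  fixes xinit :: "(real^'d)^('n::finite option)"
  assumes \<alpha>: "0 < \<alpha>" "\<alpha> < 1" and p: "1 \<le> p" "p < 1 / (1 - \<alpha>)" and K: "0 \<le> K" and u: "u \<in> control_set K T"
  obtains x where "(x, u) \<in> HK_admissible \<alpha> p T K a c xinit"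
proof -
  have um: "(\<lambda>t. axis None (u t) :: (real^'d)^('n option)) \<in> borel_measurable M"
    by (intro measurable_axis control_set_measurable[OF u])
  have ub: "norm (axis None (u t) :: (real^'d)^('n option)) \<le> K" if "t \<in> {0..T}" for t
    using order_trans[OF norm_axis_le, of "u t" K] u that by (auto simp: control_set_def)
  obtain x A where x: "x \<in> borel_measurable M" "0 \<le> A"
    "\<And>t. t \<in> {0..T} \<Longrightarrow> norm (x t) \<le> A * RL_kernel \<alpha> t"
    "\<And>t. t \<in> {0..T} \<Longrightarrow> x t = RL_integral \<alpha> (\<lambda>\<tau>. HK_drift a c (x \<tau>) + axis None (u \<tau>)) t + RL_kernel \<alpha> t *\<^sub>R xinit"
    by (rule Volterra_exists[OF \<alpha>(1) less_imp_le[OF \<alpha>(2)] bounded_linear_HK_drift[of a c] um K ub, where b = xinit])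
      (assumption, rule that, assumption, assumption, blast, blast)
  obtain k where k: "0 < k" "\<And>v :: (real^'d)^('n option). norm (HK_drift a c v) \<le> norm v * k"
    using bounded_linear.pos_bounded[OF bounded_linear_HK_drift] by blast
  have "(\<lambda>t. HK_drift a c (x t) + axis None (u t)) \<in> Lp_space p T"
  proof (rule kernel_bounded_Lp[OF \<alpha> _ p(2)])
    show "(\<lambda>t. HK_drift a c (x t) + axis None (u t)) \<in> borel_measurable M"
      by (intro borel_measurable_add um measurable_compose[OF x(1) borel_measurable_continuous_onI] linear_continuous_on bounded_linear_HK_drift)
    show "AE t in M. norm (HK_drift a c (x t) + axis None (u t)) \<le> (A * k + K * (Gamma \<alpha> * T powr (1 - \<alpha>))) * RL_kernel \<alpha> t"
      using AE_M_pos AE_space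
    proof eventually_elim
      case (elim t)
      then have t: "t \<in> {0..T}" by simp
      have "norm (HK_drift a c (x t)) \<le> A * RL_kernel \<alpha> t * k"
        using k(2)[of "x t"] mult_right_mono[OF x(3)[OF t], of k] k(1) by linarith
      moreover have "norm (axis None (u t) :: (real^'d)^('n option)) \<le> K * (Gamma \<alpha> * T powr (1 - \<alpha>)) * RL_kernel \<alpha> t"
        using ub[OF t] bounded_le_kernel[OF \<alpha>(1) less_imp_le[OF \<alpha>(2)] K, of t] elim by auto
      ultimately show ?case
        using norm_triangle_ineq[of "HK_drift a c (x t)" "axis None (u t)"] by (simp add: algebra_simps)
    qed
  qed (use p x(2) k K \<alpha> in \<open>auto simp: Gamma_real_nonneg\<close>)
  moreover have "AE t in M. x t = RL_integral \<alpha> (\<lambda>\<tau>. HK_drift a c (x \<tau>) + axis None (u \<tau>)) t + RL_kernel \<alpha> t *\<^sub>R xinit"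
    by (intro AE_I2 x(4)) simp
  ultimately have "(x, u) \<in> HK_admissible \<alpha> p T K a c xinit"
    unfolding HK_admissible_iff[OF \<alpha> p(1)] using x(1) u by blast
  then show ?thesis by (rule that)
qed

lemma HK_admissible_integrable:
  fixes xinit :: "(real^'d)^('n::finite option)"
  assumes \<alpha>: "0 < \<alpha>" "\<alpha> < 1" and p: "1 \<le> p" and adm: "(x, u) \<in> HK_admissible \<alpha> p T K a c xinit"
  shows "integrable M x" "integrable M (\<lambda>t. HK_drift a c (x t) + axis None (u t))" "u \<in> borel_measurable M"
proof -
  note A = adm[unfolded HK_admissible_iff[OF \<alpha> p]]
  show g: "integrable M (\<lambda>t. HK_drift a c (x t) + axis None (u t))"
    using A Lp_space_integrable[OF p] by blast
  have "integrable M (\<lambda>t. RL_integral \<alpha> (\<lambda>\<tau>. HK_drift a c (x \<tau>) + axis None (u \<tau>)) t + RL_kernel \<alpha> t *\<^sub>R xinit)"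
    by (rule Bochner_Integration.integrable_add[OF RL_integral_integrable[OF \<alpha>(1) g] RL_kernel_integrable[OF \<alpha>(1)]])
  then show "integrable M x"
    using A by (subst integrable_cong_AE[where g = "\<lambda>t. RL_integral \<alpha> (\<lambda>\<tau>. HK_drift a c (x \<tau>) + axis None (u \<tau>)) t + RL_kernel \<alpha> t *\<^sub>R xinit"]) auto
  show "u \<in> borel_measurable M" using A control_set_measurable by blast
qed

text \<open>Only almost everywhere, because the kernel integral of an L^1 function may diverge at
  some t. The factor \<open>r\<close> covers differences (r = - 1) and midpoints (r = 1/2).\<close>

lemma RL_integral_add_AE:
  fixes f g :: "real \<Rightarrow> 'a::euclidean_space"
  assumes \<alpha>: "0 < \<alpha>" and f: "integrable M f" and g: "integrable M g"
  shows "AE t in M. RL_integral \<alpha> (\<lambda>\<tau>. f \<tau> + r *\<^sub>R g \<tau>) t = RL_integral \<alpha> f t + r *\<^sub>R RL_integral \<alpha> g t"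
  using kernel_integrable_AE[OF \<alpha> f] kernel_integrable_AE[OF \<alpha> g] AE_space
proof eventually_elim
  case (elim t)
  have "integrable M (\<lambda>\<tau>. r *\<^sub>R (RL_kernel \<alpha> (t - \<tau>) *\<^sub>R g \<tau>))"
    using elim by (intro integrable_scaleR_right)
  then have "integrable M (\<lambda>\<tau>. RL_kernel \<alpha> (t - \<tau>) *\<^sub>R (r *\<^sub>R g \<tau>))"
    by (subst scaleR_left_commute)
  then have "RL_integral \<alpha> (\<lambda>\<tau>. f \<tau> + r *\<^sub>R g \<tau>) t = RL_integral \<alpha> f t + RL_integral \<alpha> (\<lambda>\<tau>. r *\<^sub>R g \<tau>) t"
    using elim by (intro RL_integral_add) auto
  also have "RL_integral \<alpha> (\<lambda>\<tau>. r *\<^sub>R g \<tau>) t = r *\<^sub>R RL_integral \<alpha> g t"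
    using elim by (intro RL_integral_bounded_linear bounded_linear_scaleR_right) auto
  finally show ?case .
qed

text \<open>The state equation is affine in (x, u) with a fixed initial term, and the ball of
  controls is convex.\<close>

lemma HK_admissible_midpoint:
  fixes xinit :: "(real^'d)^('n::finite option)"
  assumes \<alpha>: "0 < \<alpha>" "\<alpha> < 1" and p: "1 \<le> p"
    and x: "(x, u) \<in> HK_admissible \<alpha> p T K a c xinit" and y: "(y, v) \<in> HK_admissible \<alpha> p T K a c xinit"
  shows "((\<lambda>t. (1 / 2) *\<^sub>R (x t + y t)), (\<lambda>t. (1 / 2) *\<^sub>R (u t + v t))) \<in> HK_admissible \<alpha> p T K a c xinit"
proof -
  let ?f = "\<lambda>t. HK_drift a c (x t) + axis None (u t)" and ?g = "\<lambda>t. HK_drift a c (y t) + axis None (v t)"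
  let ?z = "\<lambda>t. (1 / 2) *\<^sub>R (x t + y t)" and ?w = "\<lambda>t. (1 / 2) *\<^sub>R (u t + v t)"
  note X = x[unfolded HK_admissible_iff[OF \<alpha> p]] and Y = y[unfolded HK_admissible_iff[OF \<alpha> p]]
  note ix = HK_admissible_integrable[OF \<alpha> p x] and iy = HK_admissible_integrable[OF \<alpha> p y]
  have [measurable]: "x \<in> borel_measurable M" "u \<in> borel_measurable M" "y \<in> borel_measurable M" "v \<in> borel_measurable M"
    using ix iy by auto
  have eq: "(\<lambda>t. HK_drift a c (?z t) + axis None (?w t)) = (\<lambda>t. (1 / 2) *\<^sub>R (?f t + ?g t))"
    by (intro ext)
       (simp add: linear_add[OF linear_HK_drift] linear_cmul[OF linear_HK_drift] linear_add[OF linear_axis] linear_cmul[OF linear_axis] scaleR_add_right)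
  have "?w \<in> control_set K T"
  proof (rule control_setI)
    fix t assume t: "t \<in> {0..T}"
    then have "norm (u t) \<le> K" "norm (v t) \<le> K" using X Y by (auto simp: control_set_def)
    then show "norm (?w t) \<le> K" using norm_triangle_ineq[of "u t" "v t"] by simp
  qed measurable
  moreover have "(\<lambda>t. (1 / 2) *\<^sub>R (?f t + ?g t)) \<in> Lp_space p T"
    using X Y p by (intro Lp_space_midpoint) auto
  moreover have "AE t in M. ?z t = RL_integral \<alpha> (\<lambda>t. (1 / 2) *\<^sub>R (?f t + ?g t)) t + RL_kernel \<alpha> t *\<^sub>R xinit"
  proof -
    have xe: "AE t in M. x t = RL_integral \<alpha> ?f t + RL_kernel \<alpha> t *\<^sub>R xinit"
      and ye: "AE t in M. y t = RL_integral \<alpha> ?g t + RL_kernel \<alpha> t *\<^sub>R xinit"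
      using X Y by blast+
    have if': "integrable M (\<lambda>t. (1 / 2) *\<^sub>R ?f t)" using ix by (intro integrable_scaleR_right)
    \<comment> \<open>With first summand 0, \<open>RL_integral_add_AE\<close> yields the homogeneity
      of I^\<alpha>; a second instance adds the other half.\<close>
    have 0: "integrable M (\<lambda>t. 0 :: (real^'d)^('n option))" by simp
    show ?thesis
      using xe ye RL_integral_add_AE[OF \<alpha>(1) if' iy(2), of "1 / 2"] RL_integral_add_AE[OF \<alpha>(1) 0 ix(2), of "1 / 2"] AE_space
    proof eventually_elim
      case (elim t)
      have "RL_integral \<alpha> (\<lambda>t. 0 :: (real^'d)^('n option)) t = 0"
        using elim by (simp add: RL_integral_eq)
      then have "RL_integral \<alpha> (\<lambda>t. (1 / 2) *\<^sub>R ?f t) t = (1 / 2) *\<^sub>R RL_integral \<alpha> ?f t"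
        using elim(4) by (simp only: add_0)
      then have e: "RL_integral \<alpha> (\<lambda>t. (1 / 2) *\<^sub>R (?f t + ?g t)) t = (1 / 2) *\<^sub>R RL_integral \<alpha> ?f t + (1 / 2) *\<^sub>R RL_integral \<alpha> ?g t"
        using elim(3) by (simp only: scaleR_add_right)
      have h: "(1 / 2) *\<^sub>R r + (1 / 2) *\<^sub>R r = r" for r :: "(real^'d)^('n option)"
        by (simp add: scaleR_add_left[symmetric])
      have "(1 / 2) *\<^sub>R (x t + y t) = (1 / 2) *\<^sub>R RL_integral \<alpha> ?f t + (1 / 2) *\<^sub>R RL_integral \<alpha> ?g t
        + ((1 / 2) *\<^sub>R (RL_kernel \<alpha> t *\<^sub>R xinit) + (1 / 2) *\<^sub>R (RL_kernel \<alpha> t *\<^sub>R xinit))"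
        unfolding elim(1,2) by (simp only: scaleR_add_right add_ac)
      then show ?case unfolding e h .
    qed
  qed
  moreover have "?z \<in> borel_measurable M" by measurable
  ultimately show ?thesis
    unfolding HK_admissible_iff[OF \<alpha> p] eq by blast
qed

text \<open>The singular terms of two admissible states cancel in the difference, which solves the
  Volterra equation with forcing B (u - v). The constant is the same for all pairs.\<close>

lemma HK_stability:
  fixes xinit :: "(real^'d)^('n::finite option)"
  assumes \<alpha>: "0 < \<alpha>" "\<alpha> < 1" and p: "1 \<le> p"
  shows "\<exists>C\<ge>0. \<forall>(x, u) \<in> HK_admissible \<alpha> p T K a c xinit. \<forall>(y, v) \<in> HK_admissible \<alpha> p T K a c xinit.
       (\<integral>\<^sup>+ t. ennreal (norm (x t - y t)) \<partial>M) \<le> ennreal C * (\<integral>\<^sup>+ t. ennreal (norm (u t - v t)) \<partial>M)"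
proof -
  obtain C where C: "0 \<le> C"
    "\<And>z w :: real \<Rightarrow> (real^'d)^('n option). integrable M z \<Longrightarrow> integrable M w \<Longrightarrow> (AE t in M. z t = RL_integral \<alpha> (\<lambda>\<tau>. HK_drift a c (z \<tau>) + w \<tau>) t) \<Longrightarrow>
      (\<integral>\<^sup>+ t. ennreal (norm (z t)) \<partial>M) \<le> ennreal C * (\<integral>\<^sup>+ t. ennreal (norm (w t)) \<partial>M)"
    using Volterra_stability[OF \<alpha>(1) bounded_linear_HK_drift] by blast
  show ?thesis
  proof (intro exI[of _ C] conjI C(1) ballI, clarify)
    fix x y :: "real \<Rightarrow> (real^'d)^('n option)" and u v
    assume x: "(x, u) \<in> HK_admissible \<alpha> p T K a c xinit" and y: "(y, v) \<in> HK_admissible \<alpha> p T K a c xinit"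
    note X = x[unfolded HK_admissible_iff[OF \<alpha> p]] and Y = y[unfolded HK_admissible_iff[OF \<alpha> p]]
    note ix = HK_admissible_integrable[OF \<alpha> p x] and iy = HK_admissible_integrable[OF \<alpha> p y]
    let ?f = "\<lambda>t. HK_drift a c (x t) + axis None (u t)" and ?g = "\<lambda>t. HK_drift a c (y t) + axis None (v t)"
    let ?z = "\<lambda>t. x t - y t" and ?w = "\<lambda>t. axis None (u t - v t) :: (real^'d)^('n option)"
    have eq: "(\<lambda>t. HK_drift a c (?z t) + ?w t) = (\<lambda>t. ?f t + (- 1) *\<^sub>R ?g t)"
      by (intro ext) (simp add: linear_diff[OF linear_HK_drift] linear_diff[OF linear_axis])
    have iz: "integrable M ?z" using ix iy by simp
    \<comment> \<open>Solving \<open>eq\<close> for the control term shows that \<open>?w\<close> is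
      a combination of integrable functions.\<close>
    have "integrable M (\<lambda>t. (?f t + (- 1) *\<^sub>R ?g t) - HK_drift a c (?z t))"
      by (rule Bochner_Integration.integrable_diff[OF
            Bochner_Integration.integrable_add[OF ix(2) integrable_scaleR_right[OF iy(2)]]
            integrable_bounded_linear[OF bounded_linear_HK_drift iz]])
    then have iw: "integrable M ?w"
      unfolding fun_cong[OF eq, symmetric] by simp
    have xe: "AE t in M. x t = RL_integral \<alpha> ?f t + RL_kernel \<alpha> t *\<^sub>R xinit"
      and ye: "AE t in M. y t = RL_integral \<alpha> ?g t + RL_kernel \<alpha> t *\<^sub>R xinit"
      using X Y by blast+
    have "AE t in M. ?z t = RL_integral \<alpha> (\<lambda>t. ?f t + (- 1) *\<^sub>R ?g t) t"
      using xe ye RL_integral_add_AE[OF \<alpha>(1) ix(2) iy(2), of "- 1"]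
      by eventually_elim simp
    then have "(\<integral>\<^sup>+ t. ennreal (norm (?z t)) \<partial>M) \<le> ennreal C * (\<integral>\<^sup>+ t. ennreal (norm (?w t)) \<partial>M)"
      unfolding eq[symmetric] by (rule C(2)[OF iz iw])
    also have "\<dots> \<le> ennreal C * (\<integral>\<^sup>+ t. ennreal (norm (u t - v t)) \<partial>M)"
      by (intro mult_left_mono nn_integral_mono ennreal_leI norm_axis_le) auto
    finally show "(\<integral>\<^sup>+ t. ennreal (norm (x t - y t)) \<partial>M) \<le> ennreal C * (\<integral>\<^sup>+ t. ennreal (norm (u t - v t)) \<partial>M)" .
  qed
qed

end

text \<open>By Tonelli for series the norms of the increments are summable almost everywhere, so the
  telescoping series converges. The whole sequence converges, with no passage to a
  subsequence.\<close>

lemma AE_convergent_of_summable_L1_increments: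
  fixes u :: "nat \<Rightarrow> 'a \<Rightarrow> 'b::{banach, second_countable_topology}"
  assumes [measurable]: "\<And>n. u n \<in> borel_measurable N"
    and sum: "(\<Sum>n. \<integral>\<^sup>+ t. ennreal (norm (u (Suc n) t - u n t)) \<partial>N) < \<infinity>"
  shows "AE t in N. convergent (\<lambda>n. u n t)"
proof -
  have "(\<integral>\<^sup>+ t. (\<Sum>n. ennreal (norm (u (Suc n) t - u n t))) \<partial>N) \<noteq> \<infinity>"
    using sum by (subst nn_integral_suminf) auto
  then have "AE t in N. (\<Sum>n. ennreal (norm (u (Suc n) t - u n t))) \<noteq> \<infinity>"
    by (intro nn_integral_PInf_AE) auto
  then show ?thesis
  proof eventually_elim
    case (elim t)
    then have "summable (\<lambda>n. norm (u (Suc n) t - u n t))"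
      by (intro summable_suminf_not_top) auto
    then have "summable (\<lambda>n. u (Suc n) t - u n t)"
      by (rule summable_norm_cancel)
    then have "(\<lambda>m. \<Sum>n<m. u (Suc n) t - u n t) \<longlonglongrightarrow> (\<Sum>n. u (Suc n) t - u n t)"
      by (rule summable_LIMSEQ)
    then have "(\<lambda>m. u m t - u 0 t) \<longlonglongrightarrow> (\<Sum>n. u (Suc n) t - u n t)"
      by (simp only: sum_lessThan_telescope[of "\<lambda>n. u n t"])
    then have "(\<lambda>m. (u m t - u 0 t) + u 0 t) \<longlonglongrightarrow> (\<Sum>n. u (Suc n) t - u n t) + u 0 t"
      by (intro tendsto_add tendsto_const)
    then show ?case by (auto simp: convergent_def)
  qed
qed

section \<open>Minimizing sequences and their limit\<close>

context horizon
begin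

text \<open>Strong convexity in the control: the midpoint of two almost optimal pairs is admissible, so the parallelogram identity
  forces their controls to be close.\<close>

lemma HK_almost_optimal_controls_close:
  fixes xinit :: "(real^'d)^('n::finite option)"
  assumes \<alpha>: "0 < \<alpha>" "\<alpha> < 1" and p: "1 \<le> p" and \<nu>: "0 < \<nu>" and e: "0 < e"
    and low: "\<And>z w. (z, w) \<in> HK_admissible \<alpha> p T K a c xinit \<Longrightarrow> m \<le> HK_cost T \<nu> z w"
    and m: "m < \<infinity>"
    and x: "(x, u) \<in> HK_admissible \<alpha> p T K a c xinit" "HK_cost T \<nu> x u \<le> m + ennreal (e\<^sup>2)"
    and y: "(y, v) \<in> HK_admissible \<alpha> p T K a c xinit" "HK_cost T \<nu> y v \<le> m + ennreal (e\<^sup>2)"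
  shows "(\<integral>\<^sup>+ t. ennreal (norm (u t - v t)) \<partial>M) \<le> ennreal ((T + 8 / \<nu>) * e)"
proof -
  define D where "D = (\<integral>\<^sup>+ t. ennreal ((norm (u t - v t))\<^sup>2) \<partial>M)"
  have [measurable]: "x \<in> borel_measurable M" "u \<in> borel_measurable M" "y \<in> borel_measurable M" "v \<in> borel_measurable M"
    using HK_admissible_integrable[OF \<alpha> p x(1)] HK_admissible_integrable[OF \<alpha> p y(1)] by auto
  \<comment> \<open>The lower bound \<open>m\<close> is applied to the midpoint pair.\<close>
  have "2 * m + ennreal (\<nu> / 4) * D \<le>
    2 * HK_cost T \<nu> (\<lambda>t. (1 / 2) *\<^sub>R (x t + y t)) (\<lambda>t. (1 / 2) *\<^sub>R (u t + v t)) + ennreal (\<nu> / 4) * D"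
    by (intro add_right_mono mult_left_mono low HK_admissible_midpoint[OF \<alpha> p x(1) y(1)]) auto
  also have "\<dots> \<le> HK_cost T \<nu> x u + HK_cost T \<nu> y v"
    unfolding D_def using \<nu> by (intro HK_cost_midpoint) auto
  also have "\<dots> \<le> (m + ennreal (e\<^sup>2)) + (m + ennreal (e\<^sup>2))"
    by (intro add_mono x y)
  also have "\<dots> = 2 * m + ennreal (2 * e\<^sup>2)"
  proof -
    have "ennreal (2 * e\<^sup>2) = ennreal (e\<^sup>2) + ennreal (e\<^sup>2)"
      by (subst ennreal_plus[symmetric]) auto
    then show ?thesis by (simp only: mult_2 add_ac)
  qed
  \<comment> \<open>In \<open>ennreal\<close> a summand can be cancelled only when it is finite;
    \<open>m < \<infinity>\<close> excludes the first alternative.\<close>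
  finally have "2 * m = \<infinity> \<or> ennreal (\<nu> / 4) * D \<le> ennreal (2 * e\<^sup>2)"
    by (simp only: ennreal_add_left_cancel_le)
  moreover have "2 * m \<noteq> \<infinity>" using m by (simp add: ennreal_mult_eq_top_iff)
  ultimately have "ennreal (\<nu> / 4) * D \<le> ennreal (2 * e\<^sup>2)" by blast
  then have "ennreal (4 / \<nu>) * (ennreal (\<nu> / 4) * D) \<le> ennreal (4 / \<nu>) * ennreal (2 * e\<^sup>2)"
    by (intro mult_left_mono) auto
  then have D: "D \<le> ennreal (8 / \<nu> * e\<^sup>2)"
    using \<nu> by (simp add: mult.assoc[symmetric] ennreal_mult[symmetric])
  \<comment> \<open>The inequality r \<le> e + r^2 / e replaces Cauchy-Schwarz: the constant e
    integrates to e T, and \<open>D\<close> divided by e is at most (8 / \<nu>) e. A cost tolerance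
    of e^2 thus gives an L^1 distance of order e.\<close>
  have "(\<integral>\<^sup>+ t. ennreal (norm (u t - v t)) \<partial>M) \<le> (\<integral>\<^sup>+ t. ennreal e + ennreal (1 / e) * ennreal ((norm (u t - v t))\<^sup>2) \<partial>M)"
  proof (intro nn_integral_mono)
    fix t
    have "r \<le> e + 1 / e * r\<^sup>2" if "0 \<le> r" for r
    proof (cases "r \<le> e")
      case False
      then have "e * r \<le> r * r" using e by (intro mult_right_mono) auto
      then have "r \<le> 1 / e * r\<^sup>2" using e by (simp add: field_simps power2_eq_square)
      then show ?thesis using e by simp
    qed (use e in \<open>simp add: add_increasing2\<close>)
    then have "norm (u t - v t) \<le> e + 1 / e * (norm (u t - v t))\<^sup>2" by simp
    then have "ennreal (norm (u t - v t)) \<le> ennreal (e + 1 / e * (norm (u t - v t))\<^sup>2)" by (rule ennreal_leI)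
    also have "\<dots> = ennreal e + ennreal (1 / e * (norm (u t - v t))\<^sup>2)"
      using e by (intro ennreal_plus) auto
    also have "ennreal (1 / e * (norm (u t - v t))\<^sup>2) = ennreal (1 / e) * ennreal ((norm (u t - v t))\<^sup>2)"
      using e by (intro ennreal_mult) auto
    finally show "ennreal (norm (u t - v t)) \<le> ennreal e + ennreal (1 / e) * ennreal ((norm (u t - v t))\<^sup>2)" .
  qed
  also have "\<dots> = ennreal e * emeasure M (space M) + ennreal (1 / e) * D"
    unfolding D_def by (subst nn_integral_add) (auto simp: nn_integral_cmult)
  also have "emeasure M (space M) = ennreal T"
    using T_pos by (simp add: emeasure_restrict_space)
  also have "ennreal e * ennreal T + ennreal (1 / e) * D \<le> ennreal e * ennreal T + ennreal (1 / e) * ennreal (8 / \<nu> * e\<^sup>2)"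
    by (intro add_left_mono mult_left_mono D) auto
  also have "\<dots> = ennreal (e * T + 1 / e * (8 / \<nu> * e\<^sup>2))"
    using e T_pos \<nu> by (simp add: ennreal_mult[symmetric] ennreal_plus[symmetric] del: ennreal_plus)
  also have "e * T + 1 / e * (8 / \<nu> * e\<^sup>2) = (T + 8 / \<nu>) * e"
    using e by (simp add: field_simps power2_eq_square)
  finally show ?thesis .
qed

theorem HK_optimal_exists:
  fixes xinit :: "(real^'d)^('n::finite option)"
  assumes \<alpha>: "0 < \<alpha>" "\<alpha> < 1" and p: "1 \<le> p" "p < 1 / (1 - \<alpha>)" and \<nu>: "0 < \<nu>" and K: "0 \<le> K"
  shows "\<exists>x u. HK_optimal \<alpha> p T \<nu> K a c xinit x u"
proof -
  define A where "A = HK_admissible \<alpha> p T K a c xinit"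
  define m where "m = (INF (x, u) \<in> A. HK_cost T \<nu> x u)"
  have low: "m \<le> HK_cost T \<nu> x u" if "(x, u) \<in> A" for x u
    unfolding m_def using INF_lower[OF that, of "\<lambda>(x, u). HK_cost T \<nu> x u"] by simp
  have optI: ?thesis if "(x, u) \<in> A" "HK_cost T \<nu> x u \<le> m" for x u
    unfolding HK_optimal_def A_def[symmetric]
    using that(1) order_trans[OF that(2) low] by (intro exI[of _ x] exI[of _ u]) blast
  have "(\<lambda>_. 0) \<in> control_set K T" using K by (intro control_setI) auto
  then obtain x0 where x0: "(x0, \<lambda>_. 0) \<in> A"
    unfolding A_def using HK_admissible_exists[OF \<alpha> p K] by metis
  show ?thesis
  proof (cases "m = \<infinity>")
    case True
    then show ?thesis using optI[OF x0] by simp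
  next
    case False
    then have mf: "m < \<infinity>" by (simp add: less_top)
    \<comment> \<open>A geometric choice makes the L^1 distances of consecutive controls
      summable.\<close>
    define e where "e = (\<lambda>n. (1 / 2 :: real) ^ n)"
    have e: "0 < e n" for n by (simp add: e_def)
    have "\<exists>x u. (x, u) \<in> A \<and> HK_cost T \<nu> x u < m + ennreal ((e n)\<^sup>2)" for n
    proof -
      \<comment> \<open>This strict inequality is where the finiteness of the infimum yields a
        minimizing sequence.\<close>
      have "m < m + ennreal ((e n)\<^sup>2)"
        using mf e[of n] by (cases m) (auto simp: ennreal_plus[symmetric] simp del: ennreal_plus intro!: ennreal_lessI add_nonneg_pos)
      then show ?thesis
        unfolding m_def INF_less_iff by (auto simp: m_def)
    qed
    then obtain x u where xu: "\<And>n. (x n, u n) \<in> A" "\<And>n. HK_cost T \<nu> (x n) (u n) < m + ennreal ((e n)\<^sup>2)"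
      by metis
    have um [measurable]: "u n \<in> borel_measurable M" and xi: "integrable M (x n)" for n
      using HK_admissible_integrable[OF \<alpha> p(1) xu(1)[unfolded A_def]] by auto
    have uc: "u n \<in> control_set K T" for n
      using xu(1)[of n] by (auto simp: A_def HK_admissible_def)
    have uK: "norm (u n t) \<le> K" if "t \<in> {0..T}" for n t
      using uc[of n] that by (auto simp: control_set_def)

    have incr: "(\<integral>\<^sup>+ t. ennreal (norm (u (Suc n) t - u n t)) \<partial>M) \<le> ennreal ((T + 8 / \<nu>) * e n)" for n
    proof (rule HK_almost_optimal_controls_close[OF \<alpha> p(1) \<nu> e low[unfolded A_def] mf])
      show "HK_cost T \<nu> (x (Suc n)) (u (Suc n)) \<le> m + ennreal ((e n)\<^sup>2)"
      proof -
        have "(e (Suc n))\<^sup>2 \<le> (e n)\<^sup>2" by (intro power_mono) (auto simp: e_def)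
        then have "m + ennreal ((e (Suc n))\<^sup>2) \<le> m + ennreal ((e n)\<^sup>2)"
          by (intro add_left_mono ennreal_leI)
        with xu(2)[of "Suc n"] show ?thesis by (rule order_trans[OF less_imp_le])
      qed
    qed (use xu less_imp_le in \<open>auto simp: A_def\<close>)
    have "(\<Sum>n. \<integral>\<^sup>+ t. ennreal (norm (u (Suc n) t - u n t)) \<partial>M) \<le> (\<Sum>n. ennreal ((T + 8 / \<nu>) * e n))"
      by (intro suminf_le incr) auto
    also have "\<dots> < \<infinity>"
    proof -
      have "summable (\<lambda>n. (T + 8 / \<nu>) * e n)"
        unfolding e_def by (intro summable_mult summable_geometric) auto
      then have "(\<Sum>n. ennreal ((T + 8 / \<nu>) * e n)) \<noteq> top"
        by (rule ennreal_suminf_neq_top)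
           (use T_pos \<nu> e in \<open>intro mult_nonneg_nonneg add_nonneg_nonneg; auto intro: less_imp_le\<close>)
      then show ?thesis by (simp add: less_top)
    qed
    finally have conv: "AE t in M. convergent (\<lambda>n. u n t)"
      by (intro AE_convergent_of_summable_L1_increments um)

    \<comment> \<open>The control set demands the bound \<open>K\<close> at every t in [0,T], not
      just almost everywhere, so the value 0 is used where the controls diverge.\<close>
    define us where "us = (\<lambda>t. if convergent (\<lambda>n. u n t) then lim (\<lambda>n. u n t) else 0)"
    have lim_us: "AE t in M. (\<lambda>n. u n t) \<longlonglongrightarrow> us t"
      using conv by eventually_elim (auto simp: us_def convergent_LIMSEQ_iff)
    have "(\<lambda>t. lim (\<lambda>n. u n t)) \<in> borel_measurable M" by measurable
    then have usm [measurable]: "us \<in> borel_measurable M"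
      by (rule borel_measurable_AE_M) (use conv in eventually_elim, simp add: us_def)
    have usK: "norm (us t) \<le> K" if t: "t \<in> {0..T}" for t
    proof (cases "convergent (\<lambda>n. u n t)")
      case True
      then have "(\<lambda>n. u n t) \<longlonglongrightarrow> us t" by (auto simp: us_def convergent_LIMSEQ_iff)
      from tendsto_norm[OF this] show ?thesis
        by (rule LIMSEQ_le_const2) (use uK[OF t] in auto)
    qed (use K in \<open>simp add: us_def\<close>)
    have "us \<in> control_set K T" using usK by (intro control_setI) auto
    then obtain xs where xs: "(xs, us) \<in> A"
      unfolding A_def by (rule HK_admissible_exists[OF \<alpha> p K])
    have xsi: "integrable M xs"
      using HK_admissible_integrable[OF \<alpha> p(1) xs[unfolded A_def]] by auto

    obtain C where "0 \<le> C" and C: "\<forall>(x, u) \<in> A. \<forall>(y, v) \<in> A.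
         (\<integral>\<^sup>+ t. ennreal (norm (x t - y t)) \<partial>M) \<le> ennreal C * (\<integral>\<^sup>+ t. ennreal (norm (u t - v t)) \<partial>M)"
      using HK_stability[OF \<alpha> p(1), of K a c xinit] unfolding A_def by blast
    have C_n: "(\<integral>\<^sup>+ t. ennreal (norm (xs t - x n t)) \<partial>M) \<le> ennreal C * (\<integral>\<^sup>+ t. ennreal (norm (us t - u n t)) \<partial>M)" for n
      using C[THEN bspec, OF xs] xu(1)[of n] by blast
    \<comment> \<open>The common bound \<open>K\<close> dominates the controls; stability then
      carries L^1 convergence over to the states.\<close>
    have "(\<lambda>n. \<integral>\<^sup>+ t. ennreal (norm (us t - u n t)) \<partial>M) \<longlonglongrightarrow> 0"
    proof (rule nn_integral_dominated_convergence_norm[where w = "\<lambda>_. K"])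
      show "AE t in M. norm (u n t) \<le> K" for n
        by (intro AE_I2 uK) simp
      show "(\<integral>\<^sup>+ t. ennreal K \<partial>M) < \<infinity>"
        by (simp add: emeasure_restrict_space emeasure_lborel_Icc_eq ennreal_mult_less_top)
    qed (use lim_us in auto)
    then have "(\<lambda>n. ennreal C * (\<integral>\<^sup>+ t. ennreal (norm (us t - u n t)) \<partial>M)) \<longlonglongrightarrow> ennreal C * 0"
      by (intro ennreal_tendsto_cmult) auto
    then have "(\<lambda>n. \<integral>\<^sup>+ t. ennreal (norm (xs t - x n t)) \<partial>M) \<longlonglongrightarrow> 0"
      by (intro tendsto_sandwich[OF _ always_eventually[OF allI[OF C_n]] tendsto_const[of 0]]) simp_all
    moreover have di: "integrable M (\<lambda>t. xs t - x n t)" for n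
      using xsi xi by simp
    ultimately have "(\<lambda>n. ennreal (\<integral>t. norm (xs t - x n t) \<partial>M)) \<longlonglongrightarrow> ennreal 0"
      by (simp add: nn_integral_eq_integral)
    then have "(\<lambda>n. \<integral>t. norm (xs t - x n t) \<partial>M) \<longlonglongrightarrow> 0"
      by (subst (asm) tendsto_ennreal_iff) auto
    \<comment> \<open>Only the states need a subsequence; the controls already converge almost
      everywhere.\<close>
    from tendsto_L1_AE_subseq[OF di this]
    obtain r where r: "strict_mono r" "AE t in M. (\<lambda>n. xs t - x (r n) t) \<longlonglongrightarrow> 0" by blast

    have xm [measurable]: "x n \<in> borel_measurable M" for n using xi by auto
    \<comment> \<open>The integrand is continuous in (x, u), so along \<open>r\<close> it converges
      almost everywhere and its liminf is the integrand of the limit pair.\<close>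
    have "HK_cost T \<nu> xs us = (\<integral>\<^sup>+ t. liminf (\<lambda>n. ennreal (HK_integrand \<nu> (x (r n) t) (u (r n) t))) \<partial>M)"
      unfolding HK_cost_eq
    proof (rule nn_integral_cong_AE)
      show "AE t in M. ennreal (HK_integrand \<nu> (xs t) (us t)) = liminf (\<lambda>n. ennreal (HK_integrand \<nu> (x (r n) t) (u (r n) t)))"
        using r(2) lim_us
      proof eventually_elim
        case (elim t)
        have "(\<lambda>n. xs t - (xs t - x (r n) t)) \<longlonglongrightarrow> xs t - 0"
          by (intro tendsto_diff tendsto_const elim)
        then have "(\<lambda>n. (x (r n) t, u (r n) t)) \<longlonglongrightarrow> (xs t, us t)"
          using LIMSEQ_subseq_LIMSEQ[OF elim(2) r(1)] by (intro tendsto_Pair) (auto simp: o_def)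
        then have "(\<lambda>n. HK_integrand \<nu> (fst (x (r n) t, u (r n) t)) (snd (x (r n) t, u (r n) t))) \<longlonglongrightarrow> HK_integrand \<nu> (fst (xs t, us t)) (snd (xs t, us t))"
          by (intro continuous_on_tendsto_compose[OF continuous_HK_integrand]) auto
        then have "(\<lambda>n. ennreal (HK_integrand \<nu> (x (r n) t) (u (r n) t))) \<longlonglongrightarrow> ennreal (HK_integrand \<nu> (xs t) (us t))"
          by (intro tendsto_ennrealI) simp
        then show ?case by (intro lim_imp_Liminf[symmetric]) auto
      qed
    qed
    also have "\<dots> \<le> liminf (\<lambda>n. HK_cost T \<nu> (x (r n)) (u (r n)))"
      unfolding HK_cost_eq
      by (intro nn_integral_liminf measurable_compose[OF _ measurable_ennreal] HK_integrand_measurable xm um)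
    also have "\<dots> \<le> liminf (\<lambda>n. m + ennreal ((e (r n))\<^sup>2))"
      by (intro Liminf_mono always_eventually allI less_imp_le xu(2))
    also have "\<dots> = m"
    proof -
      have "e \<longlonglongrightarrow> 0" unfolding e_def by (intro LIMSEQ_realpow_zero) auto
      then have "(\<lambda>n. e (r n)) \<longlonglongrightarrow> 0"
        using LIMSEQ_subseq_LIMSEQ[OF _ r(1)] by (auto simp: o_def)
      then have "(\<lambda>n. (e (r n))\<^sup>2) \<longlonglongrightarrow> 0\<^sup>2" by (intro tendsto_power)
      then have "(\<lambda>n. m + ennreal ((e (r n))\<^sup>2)) \<longlonglongrightarrow> m + ennreal (0\<^sup>2)"
        by (intro tendsto_add tendsto_const tendsto_ennrealI)
      then show ?thesis by (intro lim_imp_Liminf) auto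
    qed
    finally show ?thesis by (rule optI[OF xs])
  qed
qed

end

theorem theorem3:
  fixes \<alpha> p T \<nu> K :: real
    and a :: "'n::finite \<Rightarrow> 'n \<Rightarrow> real"
    and c :: "'n \<Rightarrow> real"
    and xinit :: "(real^'d)^('n option)"
  assumes "0 < \<alpha>" and "\<alpha> < 1"
    and "1 < p" and "p < 1 / (1 - \<alpha>)"
    and "0 < T"
    and "CARD('n) > 1"
    and "\<And>i j. 0 \<le> a i j" and "\<And>i. 0 \<le> c i"
    and "0 < \<nu>" and "0 \<le> K"
  shows "\<exists>x u. HK_optimal \<alpha> p T \<nu> K a c xinit x u"
proof -
  interpret horizon T by unfold_locales fact
  show ?thesis using assms by (intro HK_optimal_exists) auto
qed

end
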